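(* As formal power series in $q$ (with coefficients Laurent polynomials in $w$), $$\sum_{m\in\mathbb{Z}}\sum_{n\ge0}\bigl(N(3m,n)+N(3m+1,n)+N(3m-1,n)\bigr)w^mq^n=\frac{(q^3;q^3)_\infty}{(q;q)_\infty}\sum_{m\in\mathbb{Z}}\sum_{n\ge0}M(m,n)\,w^mq^{3n}.$$
   Context: $(a;q)_\infty=\prod_{j\ge0}(1-aq^j)$. The rank of a partition is its largest part minus its number of parts; $N(m,n)$ is the number of partitions of $n$ with rank $m$, with $N(0,0)=1$ and $N(m,0)=0$ for $m\ne0$, so that $\sum_{m,n}N(m,n)w^mq^n=\sum_{n\ge0}\frac{q^{n^2}}{\prod_{k=1}^n(1-wq^k)(1-q^k/w)}$. The crank of a partition is its largest part if $1$ is not a part, and $e(k)-k$ if $1$ appears exactly $k$ times, where $e(k)$ is the number of parts strictly larger than $k$; $M(m,n)$ is the number of partitions of $n$ with crank $m$ for $n\ge2$, with conventions $M(0,0)=1$, $M(m,0)=0$ for $m\ne0$, $M(0,1)=-1$, $M(\pm1,1)=1$, $M(m,1)=0$ otherwise, so that $\sum_{m,n}M(m,n)w^mq^n=\frac{(q;q)_\infty}{(wq;q)_\infty(q/w;q)_\infty}$. *)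

theory Defs
  imports
    "HOL-Analysis.Infinite_Products"
    "HOL-Computational_Algebra.Formal_Power_Series"
    "HOL-Library.Multiset"
    "HOL-Library.Poly_Mapping"
begin

definition partitions :: "nat \<Rightarrow> nat multiset set" where
  "partitions n = {p. 0 \<notin># p \<and> \<Sum>\<^sub># p = n}"

text \<open>Rank and crank are only meaningful for nonempty partitions; the values at
  \<open>n = 0\<close> (and the crank values at \<open>n = 1\<close>) are fixed separately by the
  usual conventions in the counting functions below.\<close>

definition partition_rank :: "nat multiset \<Rightarrow> int" where
  "partition_rank p = int (Max (set_mset p)) - int (size p)"

definition partition_crank :: "nat multiset \<Rightarrow> int" where
  "partition_crank p = (let k = count p 1 in
     if k = 0 then int (Max (set_mset p))
     else int (size (filter_mset (\<lambda>x. k < x) p)) - int k)"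

definition rank_count :: "int \<Rightarrow> nat \<Rightarrow> nat" where
  "rank_count m n =
     (if n = 0 then (if m = 0 then 1 else 0)
      else card {p \<in> partitions n. partition_rank p = m})"

definition crank_count :: "int \<Rightarrow> nat \<Rightarrow> int" where
  "crank_count m n =
     (if n = 0 then (if m = 0 then 1 else 0)
      else if n = 1 then (if m = 0 then - 1 else if m = 1 \<or> m = - 1 then 1 else 0)
      else int (card {p \<in> partitions n. partition_crank p = m}))"

text \<open>The type \<open>int \<Rightarrow>\<^sub>0 int\<close> with convolution product is the ring of
  Laurent polynomials in \<open>w\<close> with integer coefficients; \<open>single m c\<close> is the
  monomial \<open>c w\<^sup>m\<close>. The sum over \<open>m\<close> is a sum of finitely many nonzero terms whenever
  each \<open>\<lambda>m. a m n\<close> has finite support, and collapses to \<open>0\<close> otherwise; finiteness of the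
  supports in question is proved below.\<close>

definition laurent_gf :: "(int \<Rightarrow> nat \<Rightarrow> int) \<Rightarrow> (int \<Rightarrow>\<^sub>0 int) fps" where
  "laurent_gf a = Abs_fps (\<lambda>n. Sum_any (\<lambda>m. Poly_Mapping.single m (a m n)))"

definition qpoch_inf :: "'a::comm_ring_1 fps \<Rightarrow> 'a fps \<Rightarrow> 'a fps" where
  "qpoch_inf a q = prodinf (\<lambda>j. 1 - a * q ^ j)"

lemma lookup_laurent_gf:
  assumes "finite {m. a m n \<noteq> 0}"
  shows "Poly_Mapping.lookup (fps_nth (laurent_gf a) n) m = a m n"
proof -
  let ?S = "insert m {m. a m n \<noteq> 0}"
  have "Sum_any (\<lambda>m. Poly_Mapping.single m (a m n)) = (\<Sum>m\<in>?S. Poly_Mapping.single m (a m n))"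
    using assms by (intro Sum_any.expand_superset) auto
  thus ?thesis
    using assms by (simp add: laurent_gf_def Poly_Mapping.lookup_sum lookup_single when_def
        sum.delta del: sum.insert_remove)
qed

lemma finite_partitions: "finite (partitions n)"
proof -
  have "partitions n \<subseteq> mset ` {xs. set xs \<subseteq> {..n} \<and> length xs \<le> n}"
  proof
    fix p assume p: "p \<in> partitions n"
    obtain xs where xs: "p = mset xs" by (metis ex_mset)
    have pos: "\<forall>x\<in>set xs. 0 < x" and s: "sum_list xs = n"
      using p by (auto simp: partitions_def xs sum_mset_sum_list intro: gr0I)
    have "length xs \<le> sum_list xs" using pos by (induction xs) auto
    moreover have "set xs \<subseteq> {..n}" using s member_le_sum_list by auto
    ultimately show "p \<in> mset ` {xs. set xs \<subseteq> {..n} \<and> length xs \<le> n}"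
      using s xs by auto
  qed
  moreover have "finite {xs. set xs \<subseteq> {..n} \<and> length xs \<le> n}"
    by (rule finite_lists_length_le) simp
  ultimately show ?thesis by (meson finite_imageI finite_subset)
qed

lemma finite_rank_count_support: "finite {m. rank_count m n \<noteq> 0}"
proof (rule finite_subset)
  show "{m. rank_count m n \<noteq> 0} \<subseteq> insert 0 (partition_rank ` partitions n)"
  proof
    fix m assume "m \<in> {m. rank_count m n \<noteq> 0}"
    hence "m = 0 \<or> {p \<in> partitions n. partition_rank p = m} \<noteq> {}"
      by (auto simp: rank_count_def split: if_splits simp del: Collect_empty_eq)
    thus "m \<in> insert 0 (partition_rank ` partitions n)" by blast
  qed
qed (simp add: finite_partitions)

lemma finite_crank_count_support: "finite {m. crank_count m n \<noteq> 0}"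
proof (rule finite_subset)
  show "{m. crank_count m n \<noteq> 0} \<subseteq> {0, 1, - 1} \<union> partition_crank ` partitions n"
  proof
    fix m assume "m \<in> {m. crank_count m n \<noteq> 0}"
    hence "m \<in> {0, 1, - 1} \<or> {p \<in> partitions n. partition_crank p = m} \<noteq> {}"
      by (auto simp: crank_count_def split: if_splits simp del: Collect_empty_eq)
    thus "m \<in> {0, 1, - 1} \<union> partition_crank ` partitions n" by blast
  qed
qed (simp add: finite_partitions)

lemma finite_rank_count_triple_support:
  "finite {m. int (rank_count (3 * m) n + rank_count (3 * m + 1) n + rank_count (3 * m - 1) n) \<noteq> 0}"
proof (rule finite_subset)
  let ?S = "{m. rank_count m n \<noteq> 0}"
  show "{m. int (rank_count (3 * m) n + rank_count (3 * m + 1) n + rank_count (3 * m - 1) n) \<noteq> 0}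
    \<subseteq> (\<lambda>m. 3 * m) -` ?S \<union> (\<lambda>m. 3 * m + 1) -` ?S \<union> (\<lambda>m. 3 * m - 1) -` ?S"
    by auto
  have "finite (f -` ?S)" if "inj f" for f :: "int \<Rightarrow> int"
    by (rule finite_vimageI [OF finite_rank_count_support that])
  thus "finite ((\<lambda>m. 3 * m) -` ?S \<union> (\<lambda>m. 3 * m + 1) -` ?S \<union> (\<lambda>m. 3 * m - 1) -` ?S)"
    by (simp only: finite_Un) (simp add: inj_def)
qed

lemma qpoch_inf_has_prod:
  assumes "0 < k"
  shows "(\<lambda>j. 1 - fps_X ^ k * (fps_X ^ k) ^ j :: 'a::idom fps) has_prod
           qpoch_inf (fps_X ^ k) (fps_X ^ k)"
    and "fps_nth (qpoch_inf (fps_X ^ k) (fps_X ^ k) :: 'a fps) 0 = 1"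
proof -
  let ?f = "\<lambda>j. 1 - fps_X ^ k * (fps_X ^ k) ^ j :: 'a fps"
  let ?P = "\<lambda>n. \<Prod>j\<le>n. ?f j"
  have f: "?f j = 1 - fps_X ^ (k * Suc j)" for j
    by (simp add: power_mult [symmetric] power_add)
  have step_eq: "fps_nth (?P (Suc n)) i = fps_nth (?P n) i" if "i \<le> n" for n i
  proof -
    have lt: "i < k * Suc (Suc n)"
    proof -
      have "1 * Suc (Suc n) \<le> k * Suc (Suc n)" using assms by (intro mult_le_mono1) simp
      moreover have "i < 1 * Suc (Suc n)" using that by simp
      ultimately show ?thesis by (rule less_le_trans [rotated])
    qed
    have "?P (Suc n) = ?P n - ?P n * fps_X ^ (k * Suc (Suc n))"
      by (simp only: prod.atMost_Suc f right_diff_distrib mult_1_right)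
    hence "fps_nth (?P (Suc n)) i
        = fps_nth (?P n) i - fps_nth (?P n * fps_X ^ (k * Suc (Suc n))) i"
      by (simp only: fps_sub_nth)
    also have "fps_nth (?P n * fps_X ^ (k * Suc (Suc n))) i = 0"
      unfolding fps_X_power_mult_right_nth using lt by (simp only: if_True)
    finally show ?thesis by (simp only: diff_0_right)
  qed
  have stable: "fps_nth (?P n) i = fps_nth (?P i) i" if "i \<le> n" for n i
    using that
  proof (induction n rule: dec_induct)
    case (step m)
    show ?case using step_eq [OF step.hyps(1)] step.IH by (rule trans)
  qed (rule refl)
  define L where "L = Abs_fps (\<lambda>i. fps_nth (?P i) i)"
  have lim: "?P \<longlonglongrightarrow> L"
  proof (rule tendsto_fpsI)
    fix i
    have "\<forall>n\<ge>i. fps_nth (?P n) i = fps_nth L i"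
      unfolding L_def fps_nth_Abs_fps using stable by blast
    thus "\<forall>\<^sub>F n in sequentially. fps_nth (?P n) i = fps_nth L i"
      unfolding eventually_sequentially by blast
  qed
  have L0: "fps_nth L 0 = 1" using assms by (simp add: L_def)
  hence "L \<noteq> 0" by auto
  hence hp: "?f has_prod L"
    using lim unfolding has_prod_def raw_has_prod_def add_0_right by blast
  have L: "qpoch_inf (fps_X ^ k) (fps_X ^ k) = L"
    unfolding qpoch_inf_def by (rule has_prod_unique [OF hp, symmetric])
  show "?f has_prod qpoch_inf (fps_X ^ k) (fps_X ^ k)"
    unfolding L by (rule hp)
  show "fps_nth (qpoch_inf (fps_X ^ k) (fps_X ^ k) :: 'a fps) 0 = 1"
    unfolding L by (rule L0)
qed

text \<open>The ring of Laurent polynomials is not in class \<^class>\<open>inverse\<close>, so the reciprocal of a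
  power series with constant term \<open>1\<close> is written \<open>fps_right_inverse f 1\<close>.\<close>

lemma qpoch_inf_right_inverse:
  "qpoch_inf fps_X fps_X * fps_right_inverse (qpoch_inf fps_X fps_X) 1 = (1 :: 'a::idom fps)"
  by (rule fps_right_inverse) (use qpoch_inf_has_prod(2)[of 1, where ?'a = 'a] in simp)

end

theory Submission
  imports Defs "HOL-Computational_Algebra.Formal_Laurent_Series"
begin

text \<open>
  Let \<open>P = 1 / (q;q)\<^sub>\<infinity>\<close> and let \<open>G\<^sub>r\<close> and \<open>K\<^sub>m\<close> count the partitions of rank \<open>\<ge> r\<close> and of
  crank \<open>\<ge> m\<close>. Dyson's map gives \<open>G\<^sub>r = q\<^bsup>r+1\<^esup> (P - G\<^bsub>r+3\<^esub>)\<close>, so the series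
  \<open>H\<^sub>m = G\<^bsub>3m-1\<^esub>\<close> satisfies \<open>H\<^sub>m = q\<^bsup>3m\<^esup> (P - H\<^bsub>m+1\<^esub>)\<close>. The crank analogue is
  \<open>K\<^sub>m(q) = q\<^sup>m (P(q) - K\<^bsub>m+1\<^esub>(q))\<close>. Such a recursion has only one solution, hence
  \<open>P(q\<^sup>3) H\<^sub>m(q) = P(q) K\<^sub>m(q\<^sup>3)\<close>. The coefficient of \<open>w\<^sup>m\<close> is \<open>H\<^sub>m - H\<^bsub>m+1\<^esub>\<close> on the
  left and \<open>K\<^sub>m - K\<^bsub>m+1\<^esub>\<close> on the right for \<open>m \<ge> 1\<close>; at \<open>m = 0\<close> it is \<open>P - 2 H\<^sub>1\<close> and
  \<open>P - 2 K\<^sub>1\<close> by the symmetry of rank and crank, which also settles \<open>m < 0\<close>.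

  The crank recursion comes from the double sum
  \<open>\<Sum>M(m,n) w\<^sup>m q\<^sup>n = (1 - q) \<Sum>\<^bsub>j,k\<^esub> w\<^bsup>j-k\<^esup> q\<^bsup>jk+j+k\<^esup> / ((q;q)\<^sub>j (q;q)\<^sub>k)\<close>, which is visibly symmetric:
  \<open>k\<close> is the number of ones and \<open>j\<close> the number of parts larger than \<open>k\<close> (the largest part
  if \<open>k = 0\<close>). Termwise it yields
  \<open>(1 - q\<^sup>m) M\<^sub>m = q M\<^bsub>m-1\<^esub> - q\<^bsup>m+1\<^esup> M\<^bsub>m+1\<^esub>\<close>.
\<close>

section \<open>Generating functions of sets of multisets\<close>

definition mset_gf :: "nat multiset set \<Rightarrow> 'a::comm_ring_1 fps" where
  "mset_gf S = Abs_fps (\<lambda>n. of_nat (card {s \<in> S. \<Sum>\<^sub># s = n}))"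

text \<open>\<open>card\<close> sends infinite sets to 0, so additivity and multiplicativity of
  \<open>mset_gf\<close> rest on having finitely many members of each weight. Zero parts carry no
  weight, so this is a real restriction.\<close>

definition finite_levels :: "nat multiset set \<Rightarrow> bool" where
  "finite_levels S \<longleftrightarrow> (\<forall>n. finite {s \<in> S. \<Sum>\<^sub># s = n})"

lemma mset_gf_nth: "fps_nth (mset_gf S) n = of_nat (card {s \<in> S. \<Sum>\<^sub># s = n})"
  by (simp add: mset_gf_def)

lemma finite_levels_subset:
  assumes "finite_levels T" "S \<subseteq> T"
  shows "finite_levels S"
  unfolding finite_levels_def
proof
  fix n
  have "{s \<in> S. \<Sum>\<^sub># s = n} \<subseteq> {s \<in> T. \<Sum>\<^sub># s = n}" using assms(2) by blast
  thus "finite {s \<in> S. \<Sum>\<^sub># s = n}"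
    using assms(1) by (auto simp: finite_levels_def intro: finite_subset)
qed

lemma mset_gf_Un:
  assumes "finite_levels U" "U = S \<union> T" "S \<inter> T = {}"
  shows "mset_gf U = mset_gf S + mset_gf T"
proof (rule fps_ext)
  fix n
  have "{s \<in> U. \<Sum>\<^sub># s = n} = {s \<in> S. \<Sum>\<^sub># s = n} \<union> {s \<in> T. \<Sum>\<^sub># s = n}"
    using assms(2) by auto
  moreover from this have "card {s \<in> U. \<Sum>\<^sub># s = n} =
      card {s \<in> S. \<Sum>\<^sub># s = n} + card {s \<in> T. \<Sum>\<^sub># s = n}"
    using assms(1,3) unfolding finite_levels_def
    by (metis (no_types, lifting) card_Un_disjoint disjoint_iff finite_Un mem_Collect_eq)
  ultimately show "fps_nth (mset_gf U) n = fps_nth (mset_gf S + mset_gf T) n"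
    by (simp add: mset_gf_nth)
qed

lemma mset_gf_shift:
  assumes "inj_on f S" "\<And>s. s \<in> S \<Longrightarrow> \<Sum>\<^sub># (f s) = \<Sum>\<^sub># s + d"
  shows "mset_gf (f ` S) = fps_X ^ d * mset_gf S"
proof (rule fps_ext)
  fix n
  have "{s \<in> f ` S. \<Sum>\<^sub># s = n} = (if n < d then {} else f ` {s \<in> S. \<Sum>\<^sub># s = n - d})"
    using assms(2) by auto
  moreover have "card (f ` {s \<in> S. \<Sum>\<^sub># s = n - d}) = card {s \<in> S. \<Sum>\<^sub># s = n - d}"
    by (rule card_image) (rule inj_on_subset[OF assms(1)], auto)
  ultimately show "fps_nth (mset_gf (f ` S)) n = fps_nth (fps_X ^ d * mset_gf S) n"
    by (simp add: mset_gf_nth fps_X_power_mult_nth)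
qed

text \<open>Sorting the pairs by the weight of the first component gives the Cauchy product;
  \<open>d\<close> is the weight that gluing by \<open>h\<close> adds.\<close>

lemma mset_gf_times:
  assumes "finite_levels S" "finite_levels T" "inj_on h (S \<times> T)"
    and "\<And>s t. s \<in> S \<Longrightarrow> t \<in> T \<Longrightarrow> \<Sum>\<^sub># (h (s, t)) = \<Sum>\<^sub># s + \<Sum>\<^sub># t + d"
  shows "mset_gf (h ` (S \<times> T)) = fps_X ^ d * mset_gf S * mset_gf T"
proof (rule fps_ext)
  fix n
  let ?L = "\<lambda>S n. {s \<in> S. \<Sum>\<^sub># s = n}"
  let ?U = "\<lambda>n. \<Union>i\<in>{0..n}. ?L S i \<times> ?L T (n - i)"
  have "?L (h ` (S \<times> T)) n = (if n < d then {} else h ` ?U (n - d))"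
    using assms(4) by (force simp: image_iff)
  moreover have "card (h ` ?U m) = card (?U m)" for m
    by (rule card_image) (rule inj_on_subset[OF assms(3)], auto)
  moreover have "card (?U m) = (\<Sum>i=0..m. card (?L S i) * card (?L T (m - i)))" for m
    using assms(1,2) unfolding finite_levels_def card_cartesian_product[symmetric]
    by (intro card_UN_disjoint) auto
  ultimately show "fps_nth (mset_gf (h ` (S \<times> T))) n = fps_nth (fps_X ^ d * mset_gf S * mset_gf T) n"
    unfolding mult.assoc fps_X_power_mult_nth mset_gf_nth by (simp add: mset_gf_nth fps_mult_nth del: diff_diff_left)
qed

section \<open>The families of multisets to be counted\<close>

definition positive_msets :: "nat multiset set" where
  "positive_msets = {p. 0 \<notin># p}"

text \<open>For \<open>0 < a\<close> the generating function is
  \<open>1 / ((1-q^a) ... (1-q^k))\<close>.\<close>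

definition parts_in :: "nat \<Rightarrow> nat \<Rightarrow> nat multiset set" where
  "parts_in a k = {s. set_mset s \<subseteq> {a..k}}"

text \<open>Zero parts are allowed in \<open>sized_msets j\<close> and \<open>box_msets a l\<close>, which therefore encode the
  partitions with at most \<open>j\<close> (resp. \<open>l\<close>) parts.\<close>

definition sized_msets :: "nat \<Rightarrow> nat multiset set" where
  "sized_msets j = {s. size s = j}"

definition box_msets :: "nat \<Rightarrow> nat \<Rightarrow> nat multiset set" where
  "box_msets a l = {s. size s = l \<and> set_mset s \<subseteq> {..a}}"

lemma partitions_eq: "partitions n = {p \<in> positive_msets. \<Sum>\<^sub># p = n}"
  by (auto simp: partitions_def positive_msets_def)

lemma finite_levels_positive: "finite_levels positive_msets"
  unfolding finite_levels_def partitions_eq[symmetric] by (simp add: finite_partitions)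

lemma finite_levels_parts_in: "a > 0 \<Longrightarrow> finite_levels (parts_in a k)"
  by (rule finite_levels_subset[OF finite_levels_positive])
     (auto simp: parts_in_def positive_msets_def)

lemma finite_levels_sized: "finite_levels (sized_msets j)"
  unfolding finite_levels_def
proof
  fix n
  have "{s \<in> sized_msets j. \<Sum>\<^sub># s = n} \<subseteq> mset ` {xs. set xs \<subseteq> {..n} \<and> length xs = j}"
  proof
    fix s assume s: "s \<in> {s \<in> sized_msets j. \<Sum>\<^sub># s = n}"
    obtain xs where xs: "s = mset xs" by (metis ex_mset)
    with s have "length xs = j" "sum_list xs = n" by (auto simp: sized_msets_def sum_mset_sum_list)
    thus "s \<in> mset ` {xs. set xs \<subseteq> {..n} \<and> length xs = j}"
      using xs member_le_sum_list by fastforce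
  qed
  thus "finite {s \<in> sized_msets j. \<Sum>\<^sub># s = n}"
    by (rule finite_subset) (simp add: finite_lists_length_eq)
qed

lemma finite_levels_box: "finite_levels (box_msets a l)"
  by (rule finite_levels_subset[OF finite_levels_sized[of l]]) (auto simp: box_msets_def sized_msets_def)

section \<open>Recurrences from removing an extreme part or a column\<close>

lemma sum_mset_image_Suc: "\<Sum>\<^sub># (image_mset Suc s) = \<Sum>\<^sub># s + size s"
  by (induction s) auto

lemma sum_mset_image_add: "(\<Sum>x\<in>#s. x + c) = \<Sum>\<^sub># s + size s * c" for c :: nat
  by (induction s) auto

lemma image_Suc_pred: "0 \<notin># s \<Longrightarrow> image_mset Suc (image_mset (\<lambda>x. x - 1) s) = s"
  by (induction s) auto

text \<open>A member either avoids \<open>k\<close> or arises from exactly one member by adding a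
  copy of \<open>k\<close>, which contributes \<open>q^k\<close>.\<close>

lemma mset_gf_parts_in:
  assumes "0 < a" "a \<le> k"
  shows "(1 - fps_X ^ k) * mset_gf (parts_in a k) = mset_gf (parts_in a (k - 1))"
proof -
  have "parts_in a k = parts_in a (k - 1) \<union> add_mset k ` parts_in a k" (is "_ = ?L \<union> ?R")
  proof (intro equalityI subsetI)
    fix s assume s: "s \<in> parts_in a k"
    show "s \<in> ?L \<union> ?R"
    proof (cases "k \<in># s")
      case True
      then obtain t where "s = add_mset k t" by (metis insert_DiffM)
      with s show ?thesis by (auto simp: parts_in_def)
    next
      case False
      have "x \<in> {a..k - 1}" if "x \<in># s" for x
      proof -
        have "x \<in> {a..k}" using s that by (auto simp: parts_in_def)
        moreover have "x \<noteq> k" using that False by auto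
        ultimately show ?thesis by auto
      qed
      thus ?thesis by (auto simp: parts_in_def)
    qed
  qed (use assms in \<open>fastforce simp: parts_in_def\<close>)
  moreover have "?L \<inter> ?R = {}" using assms by (auto simp: parts_in_def)
  ultimately have "mset_gf (parts_in a k) = (mset_gf ?L + mset_gf ?R :: 'a fps)"
    by (rule mset_gf_Un[OF finite_levels_parts_in[OF assms(1)]])
  also have "mset_gf ?R = (fps_X ^ k * mset_gf (parts_in a k) :: 'a fps)"
    by (rule mset_gf_shift) (auto simp: inj_on_def)
  finally show ?thesis by (simp add: algebra_simps)
qed

lemma mset_gf_empty_mset: "mset_gf {s. s = {#}} = 1" and mset_gf_replicate0: "mset_gf {replicate_mset l 0} = 1"
proof -
  have "{s. s = r \<and> \<Sum>\<^sub># s = n} = (if n = \<Sum>\<^sub># r then {r} else {})" for r and n :: nat by auto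
  thus "mset_gf {s. s = {#}} = (1 :: 'a fps)" "mset_gf {replicate_mset l 0} = (1 :: 'b fps)"
    by (auto intro!: fps_ext simp: mset_gf_nth)
qed

lemma mset_gf_sized_0: "mset_gf (sized_msets 0) = 1"
  using mset_gf_empty_mset by (simp add: sized_msets_def)

lemma zero_or_Suc_split:
  fixes s :: "nat multiset"
  obtains t where "s = add_mset 0 t" | t where "s = image_mset Suc t"
  by (metis image_Suc_pred insert_DiffM)

lemma zero_notin_image_Suc: "add_mset 0 s \<noteq> image_mset Suc t"
proof
  assume "add_mset 0 s = image_mset Suc t"
  hence "0 \<in># image_mset Suc t" by (metis union_single_eq_member)
  thus False by auto
qed

lemma inj_image_Suc: "inj_on (image_mset Suc) S"
  by (rule inj_onI) (metis multiset.inj_map_strong nat.inject)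

text \<open>Dropping a zero part keeps the weight and lowers the size; if there is none, lowering
  all \<open>Suc j\<close> parts by one accounts for \<open>q^(j+1)\<close>. Thus
  \<open>mset_gf (sized_msets j)\<close> is \<open>1 / (q;q)_j\<close>.\<close>

lemma mset_gf_sized:
  "(1 - fps_X ^ Suc j) * mset_gf (sized_msets (Suc j)) = mset_gf (sized_msets j)"
proof -
  have "sized_msets (Suc j) = add_mset 0 ` sized_msets j \<union> image_mset Suc ` sized_msets (Suc j)"
    (is "_ = ?L \<union> ?R")
  proof (intro equalityI subsetI)
    fix s assume "s \<in> sized_msets (Suc j)"
    then show "s \<in> ?L \<union> ?R"
      by (cases s rule: zero_or_Suc_split) (auto simp: sized_msets_def)
  qed (auto simp: sized_msets_def)
  moreover have "?L \<inter> ?R = {}" by (auto simp: zero_notin_image_Suc)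
  ultimately have "mset_gf (sized_msets (Suc j)) = (mset_gf ?L + mset_gf ?R :: 'a fps)"
    by (rule mset_gf_Un[OF finite_levels_sized])
  also have "mset_gf ?L = (fps_X ^ 0 * mset_gf (sized_msets j) :: 'a fps)"
    by (rule mset_gf_shift) (auto simp: inj_on_def)
  also have "mset_gf ?R = (fps_X ^ Suc j * mset_gf (sized_msets (Suc j)) :: 'a fps)"
    by (rule mset_gf_shift[OF inj_image_Suc]) (auto simp: sum_mset_image_Suc sized_msets_def)
  finally show ?thesis by (simp add: algebra_simps)
qed

text \<open>The first q-Pascal rule: \<open>mset_gf (box_msets a l)\<close> is the Gaussian binomial
  coefficient of \<open>a + l\<close> over \<open>l\<close>. Either a zero part is dropped or all
  \<open>Suc l\<close> parts are lowered by one.\<close>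

lemma mset_gf_box_remove_zero:
  "mset_gf (box_msets (Suc a) (Suc l)) =
     mset_gf (box_msets (Suc a) l) + fps_X ^ Suc l * mset_gf (box_msets a (Suc l))"
proof -
  have "box_msets (Suc a) (Suc l) = add_mset 0 ` box_msets (Suc a) l \<union> image_mset Suc ` box_msets a (Suc l)"
    (is "_ = ?L \<union> ?R")
  proof (intro equalityI subsetI)
    fix s assume s: "s \<in> box_msets (Suc a) (Suc l)"
    then show "s \<in> ?L \<union> ?R"
    proof (cases s rule: zero_or_Suc_split)
      case (2 t)
      with s have "t \<in> box_msets a (Suc l)" by (auto simp: box_msets_def)
      with 2 show ?thesis by blast
    qed (auto simp: box_msets_def)
  qed (auto simp: box_msets_def)
  moreover have "?L \<inter> ?R = {}" by (auto simp: zero_notin_image_Suc)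
  ultimately have "mset_gf (box_msets (Suc a) (Suc l)) = (mset_gf ?L + mset_gf ?R :: 'a fps)"
    by (rule mset_gf_Un[OF finite_levels_box])
  also have "mset_gf ?L = (fps_X ^ 0 * mset_gf (box_msets (Suc a) l) :: 'a fps)"
    by (rule mset_gf_shift) (auto simp: inj_on_def)
  also have "mset_gf ?R = (fps_X ^ Suc l * mset_gf (box_msets a (Suc l)) :: 'a fps)"
    by (rule mset_gf_shift[OF inj_image_Suc]) (auto simp: sum_mset_image_Suc box_msets_def)
  finally show ?thesis by simp
qed

text \<open>The second q-Pascal rule, from whether the largest admissible part \<open>Suc a\<close>
  occurs.\<close>

lemma mset_gf_box_remove_max:
  "mset_gf (box_msets (Suc a) (Suc l)) =
     mset_gf (box_msets a (Suc l)) + fps_X ^ Suc a * mset_gf (box_msets (Suc a) l)"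
proof -
  have "box_msets (Suc a) (Suc l) = box_msets a (Suc l) \<union> add_mset (Suc a) ` box_msets (Suc a) l"
    (is "_ = ?L \<union> ?R")
  proof (intro equalityI subsetI)
    fix s assume s: "s \<in> box_msets (Suc a) (Suc l)"
    show "s \<in> ?L \<union> ?R"
    proof (cases "Suc a \<in># s")
      case True
      then obtain t where "s = add_mset (Suc a) t" by (metis insert_DiffM)
      with s show ?thesis by (auto simp: box_msets_def)
    next
      case False
      with s show ?thesis by (auto simp: box_msets_def) (metis atMost_iff le_Suc_eq subset_iff)
    qed
  qed (fastforce simp: box_msets_def)
  moreover have "?L \<inter> ?R = {}" by (auto simp: box_msets_def)
  ultimately have "mset_gf (box_msets (Suc a) (Suc l)) = (mset_gf ?L + mset_gf ?R :: 'a fps)"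
    by (rule mset_gf_Un[OF finite_levels_box])
  also have "mset_gf ?R = (fps_X ^ Suc a * mset_gf (box_msets (Suc a) l) :: 'a fps)"
    by (rule mset_gf_shift) (auto simp: inj_on_def)
  finally show ?thesis .
qed

text \<open>The counting form of conjugation inside a box: exchanging \<open>a\<close> and
  \<open>l\<close> turns one q-Pascal rule into the other, so induction on \<open>a + l\<close>
  replaces the construction of conjugates.\<close>

lemma mset_gf_box_commute: "mset_gf (box_msets a l) = (mset_gf (box_msets l a) :: 'a::comm_ring_1 fps)"
proof (induction "a + l" arbitrary: a l rule: less_induct)
  case less
  have z: "mset_gf (box_msets a 0) = (1 :: 'a fps)" "mset_gf (box_msets 0 l) = (1 :: 'a fps)" for a l
  proof -
    have "s = replicate_mset l 0" if "s \<in> box_msets 0 l" for s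
      using that set_mset_subset_singletonD[of s 0] by (simp add: box_msets_def)
    hence "box_msets a 0 = {s. s = {#}}" "box_msets 0 l = {replicate_mset l 0}"
      by (auto simp: box_msets_def split: if_splits)
    thus "mset_gf (box_msets a 0) = (1 :: 'a fps)" "mset_gf (box_msets 0 l) = (1 :: 'a fps)"
      by (simp_all only: mset_gf_empty_mset mset_gf_replicate0)
  qed
  show ?case
  proof (cases a; cases l)
    fix a' l' assume [simp]: "a = Suc a'" "l = Suc l'"
    show ?thesis
      using less[of "Suc a'" l'] less[of a' "Suc l'"]
      by (simp add: mset_gf_box_remove_zero[of a' l'] mset_gf_box_remove_max[of l' a'])
  qed (simp_all add: z)
qed

section \<open>The rank\<close>

text \<open>\<open>Max\<close> of the empty set is unspecified; rank 0 for the empty partition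
  encodes the convention at \<open>n = 0\<close>.\<close>

definition rank_ext :: "nat multiset \<Rightarrow> int" where
  "rank_ext p = (if p = {#} then 0 else partition_rank p)"

lemma partitions_0: "partitions 0 = {{#}}"
  by (auto simp: partitions_def) (metis multiset_nonemptyE)

lemma rank_count_eq: "rank_count m n = card {p \<in> partitions n. rank_ext p = m}"
proof (cases "n = 0")
  case True
  have "{p \<in> partitions 0. rank_ext p = m} = (if m = 0 then {{#}} else {})"
    by (auto simp: partitions_0 rank_ext_def)
  with True show ?thesis by (simp add: rank_count_def)
next
  case False
  hence "{#} \<notin> partitions n" by (auto simp: partitions_def)
  hence "{p \<in> partitions n. rank_ext p = m} = {p \<in> partitions n. partition_rank p = m}"
    by (auto simp: rank_ext_def)
  with False show ?thesis by (simp add: rank_count_def)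
qed

section \<open>Symmetry of the rank\<close>

definition shape_msets :: "nat \<Rightarrow> nat \<Rightarrow> nat multiset set" where
  "shape_msets a l = {p \<in> positive_msets. p \<noteq> {#} \<and> Max (set_mset p) = a \<and> size p = l}"

text \<open>Removing the largest row and the first column takes away a hook of
  \<open>a + l + 1\<close> cells and leaves a partition inside an \<open>a\<close> by
  \<open>l\<close> box.\<close>

lemma mset_gf_shape:
  "mset_gf (shape_msets (Suc a) (Suc l)) = fps_X ^ (a + l + 1) * mset_gf (box_msets a l)"
proof -
  let ?f = "\<lambda>s. add_mset (Suc a) (image_mset Suc s)"
  have "shape_msets (Suc a) (Suc l) = ?f ` box_msets a l"
  proof (intro equalityI subsetI)
    fix p assume p: "p \<in> shape_msets (Suc a) (Suc l)"
    hence ne: "p \<noteq> {#}" and M: "Max (set_mset p) = Suc a" and pos: "0 \<notin># p" and sz: "size p = Suc l"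
      by (auto simp: shape_msets_def positive_msets_def)
    have "Suc a \<in># p" using Max_in[of "set_mset p"] ne M by simp
    then obtain t where t: "p = add_mset (Suc a) t" by (metis insert_DiffM)
    define s where "s = image_mset (\<lambda>x. x - 1) t"
    have "t = image_mset Suc s" unfolding s_def using pos t by (intro image_Suc_pred[symmetric]) auto
    moreover have "x \<le> Suc a" if "x \<in># p" for x
      using Max_ge[of "set_mset p" x] M that by simp
    ultimately have "s \<in> box_msets a l" using t sz by (auto simp: box_msets_def)
    thus "p \<in> ?f ` box_msets a l" using t \<open>t = image_mset Suc s\<close> by blast
  next
    fix p assume "p \<in> ?f ` box_msets a l"
    then obtain s where s: "s \<in> box_msets a l" "p = ?f s" by blast
    have "Max (set_mset p) = Suc a" using s by (intro Max_eqI) (auto simp: box_msets_def)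
    thus "p \<in> shape_msets (Suc a) (Suc l)"
      using s by (auto simp: shape_msets_def positive_msets_def box_msets_def)
  qed
  also have "mset_gf (?f ` box_msets a l) = (fps_X ^ (a + l + 1) * mset_gf (box_msets a l) :: 'a fps)"
  proof (rule mset_gf_shift)
    show "inj_on ?f (box_msets a l)"
      by (rule inj_onI) (use inj_image_Suc[of UNIV] in \<open>auto simp: inj_on_def\<close>)
  qed (auto simp: sum_mset_image_Suc box_msets_def)
  finally show ?thesis .
qed

lemma card_shape_commute:
  "card {p \<in> shape_msets a l. \<Sum>\<^sub># p = n} = card {p \<in> shape_msets l a. \<Sum>\<^sub># p = n}"
proof (cases "a = 0 \<or> l = 0")
  case True
  have "p \<notin> shape_msets 0 k \<and> p \<notin> shape_msets k 0" for p k
  proof (cases "p = {#} \<or> 0 \<in># p")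
    case False
    hence "Max (set_mset p) \<in># p" by (intro Max_in) auto
    with False have "Max (set_mset p) \<noteq> 0" by metis
    with False show ?thesis by (simp add: shape_msets_def)
  qed (auto simp: shape_msets_def positive_msets_def)
  hence "shape_msets 0 k = {}" "shape_msets k 0 = {}" for k by blast+
  with True show ?thesis by auto
next
  case False
  then obtain a' l' where [simp]: "a = Suc a'" "l = Suc l'" by (metis not0_implies_Suc)
  have "mset_gf (shape_msets a l) = (mset_gf (shape_msets l a) :: int fps)"
    by (simp add: mset_gf_shape mset_gf_box_commute[of a'] add.commute)
  hence "fps_nth (mset_gf (shape_msets a l)) n = (fps_nth (mset_gf (shape_msets l a)) n :: int)"
    by simp
  thus ?thesis by (simp add: mset_gf_nth)
qed

lemma member_le_sum_mset: "x \<in># p \<Longrightarrow> x \<le> \<Sum>\<^sub># p" for x :: nat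
  by (auto dest!: multi_member_split)

lemma size_le_sum_mset: "0 \<notin># p \<Longrightarrow> size p \<le> \<Sum>\<^sub># p" for p :: "nat multiset"
  by (induction p) auto

text \<open>Exchanging largest part and size by \<open>card_shape_commute\<close> negates the rank.
  The predicate \<open>Q\<close> is general because both windows of ranks and half-lines get
  reflected later.\<close>

lemma card_rank_reflect:
  "card {p \<in> partitions n. Q (rank_ext p)} = card {p \<in> partitions n. Q (- rank_ext p)}"
proof (cases "n = 0")
  case True
  have "{p \<in> partitions 0. Q (rank_ext p)} = {p \<in> partitions 0. Q (- rank_ext p)}"
    by (auto simp: partitions_0 rank_ext_def)
  with True show ?thesis by simp
next
  case False
  let ?T = "{..n} \<times> {..n}"
  let ?g = "\<lambda>p :: nat multiset. (Max (set_mset p), size p)"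
  have pe: "p \<in> partitions n \<longleftrightarrow> p \<in> positive_msets \<and> p \<noteq> {#} \<and> \<Sum>\<^sub># p = n" for p
    using False by (auto simp: partitions_eq)
  have g: "?g p \<in> ?T" if "p \<in> partitions n" for p
  proof -
    have p: "0 \<notin># p" "p \<noteq> {#}" "\<Sum>\<^sub># p = n" using that by (simp_all add: pe positive_msets_def)
    hence "Max (set_mset p) \<in># p" by (intro Max_in) simp_all
    with p show ?thesis using member_le_sum_mset[of "Max (set_mset p)" p] size_le_sum_mset[of p]
      by (simp only: mem_Sigma_iff atMost_iff simp_thms)
  qed
  \<comment> \<open>Partitions are grouped by largest part and size, both at most \<open>n\<close>;
    the rank is constant on each group.\<close>
  have fibre: "card {p \<in> partitions n. R (rank_ext p)} =
      (\<Sum>(a, l)\<in>?T. if R (int a - int l) then card {p \<in> shape_msets a l. \<Sum>\<^sub># p = n} else 0)" for R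
  proof -
    let ?S = "{p \<in> partitions n. R (rank_ext p)}"
    have "card ?S = (\<Sum>p\<in>?S. 1)" by simp
    also have "\<dots> = (\<Sum>y\<in>?T. \<Sum>p\<in>{p \<in> ?S. ?g p = y}. 1)"
      by (rule sum.group[where g = ?g, symmetric])
         (simp_all add: finite_partitions, use g in blast)
    also have "\<dots> = (\<Sum>(a, l)\<in>?T. if R (int a - int l) then card {p \<in> shape_msets a l. \<Sum>\<^sub># p = n} else 0)"
    proof (intro sum.cong refl, clarify)
      fix a l
      have "{p \<in> ?S. ?g p = (a, l)} =
          (if R (int a - int l) then {p \<in> shape_msets a l. \<Sum>\<^sub># p = n} else {})"
        by (auto simp: pe shape_msets_def rank_ext_def partition_rank_def)
      thus "(\<Sum>p\<in>{p \<in> ?S. ?g p = (a, l)}. 1) =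
          (if R (int a - int l) then card {p \<in> shape_msets a l. \<Sum>\<^sub># p = n} else 0)"
        by simp
    qed
    finally show ?thesis .
  qed
  have "card {p \<in> partitions n. Q (rank_ext p)} =
      (\<Sum>a\<le>n. \<Sum>l\<le>n. if Q (int a - int l) then card {p \<in> shape_msets a l. \<Sum>\<^sub># p = n} else 0)"
    using fibre[of Q] by (simp add: sum.cartesian_product)
  also have "\<dots> = (\<Sum>l\<le>n. \<Sum>a\<le>n. if Q (- (int l - int a)) then card {p \<in> shape_msets l a. \<Sum>\<^sub># p = n} else 0)"
  proof (subst sum.swap, rule sum.cong[OF refl], rule sum.cong[OF refl])
    fix l a
    show "(if Q (int a - int l) then card {p \<in> shape_msets a l. \<Sum>\<^sub># p = n} else 0) =
        (if Q (- (int l - int a)) then card {p \<in> shape_msets l a. \<Sum>\<^sub># p = n} else 0)"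
      using card_shape_commute[of a l n] by simp
  qed
  also have "\<dots> = card {p \<in> partitions n. Q (- rank_ext p)}"
    using fibre[of "\<lambda>i. Q (- i)"] by (simp add: sum.cartesian_product)
  finally show ?thesis .
qed

section \<open>Dyson's map and the rank tails\<close>

definition dec_mset :: "nat multiset \<Rightarrow> nat multiset" where
  "dec_mset p = filter_mset (\<lambda>x. 0 < x) (image_mset (\<lambda>x. x - 1) p)"

lemma size_dec_mset: "size (dec_mset p) \<le> size p"
  by (induction p) (auto simp: dec_mset_def)

lemma sum_dec_mset: "0 \<notin># p \<Longrightarrow> \<Sum>\<^sub># (dec_mset p) + size p = \<Sum>\<^sub># p"
  by (induction p) (auto simp: dec_mset_def)

text \<open>\<open>dec_mset\<close> deletes the first column of the Ferrers diagram. The rows wiped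
  out are the parts 1, and the drop in size counts them, so \<open>p\<close> is recovered once
  \<open>size p\<close> is known.\<close>

lemma dec_mset_inverse:
  "0 \<notin># p \<Longrightarrow> image_mset Suc (dec_mset p) + replicate_mset (size p - size (dec_mset p)) 1 = p"
proof (induction p)
  case (add x p)
  show ?case
  proof (cases "x = 1")
    case True
    hence "dec_mset (add_mset x p) = dec_mset p" by (simp add: dec_mset_def)
    thus ?thesis using add True size_dec_mset[of p] by (simp add: Suc_diff_le)
  next
    case False
    with add.prems have x: "1 < x" by (cases x) auto
    hence "dec_mset (add_mset x p) = add_mset (x - 1) (dec_mset p)"
      by (simp add: dec_mset_def)
    thus ?thesis using add x by simp
  qed
qed (simp add: dec_mset_def)

lemma dec_mset_Suc_replicate:
  assumes "0 \<notin># t"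
  shows "dec_mset (image_mset Suc t + replicate_mset k 1) = t"
proof -
  have "filter_mset (\<lambda>x. 0 < x) t = t"
  proof (rule multiset_eqI)
    fix x
    show "count (filter_mset (\<lambda>x. 0 < x) t) x = count t x"
      using assms by (cases "x = 0") (simp_all add: not_in_iff)
  qed
  thus ?thesis by (simp add: dec_mset_def multiset.map_comp comp_def)
qed

definition rank_ge :: "nat \<Rightarrow> nat multiset set" where
  "rank_ge r = {p \<in> positive_msets. p \<noteq> {#} \<and> int r \<le> partition_rank p}"

text \<open>Dyson's map: delete the first column of the Ferrers diagram and add it, lengthened by
  \<open>r + 1\<close>, as a new largest row.\<close>

lemma mset_gf_rank_ge_shift:
  "mset_gf (rank_ge r) = fps_X ^ (r + 1) * mset_gf {p \<in> positive_msets. rank_ext p < int (r + 3)}"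
proof -
  let ?D = "{p \<in> positive_msets. rank_ext p < int (r + 3)}"
  let ?f = "\<lambda>p. add_mset (size p + r + 1) (dec_mset p)"
  \<comment> \<open>The inverse: the largest row \<open>a\<close> is shortened by
    \<open>r + 1\<close> and stood up as a first column; its cells below the rows of
    \<open>t\<close> become parts 1.\<close>
  let ?g = "\<lambda>q. let a = Max (set_mset q); t = q - {#a#}
               in image_mset Suc t + replicate_mset (a - (r + 1) - size t) 1"
  \<comment> \<open>Hence no part exceeds \<open>size p + r + 1\<close> once the first column is
    gone, so the added row is a largest part.\<close>
  have D: "p \<in> ?D \<longleftrightarrow> 0 \<notin># p \<and> (\<forall>x\<in>#p. x \<le> size p + r + 2)" for p
  proof (cases "p = {#}")
    case False
    hence "rank_ext p < int (r + 3) \<longleftrightarrow> int (Max (set_mset p)) - int (size p) < int (r + 3)"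
      by (simp only: rank_ext_def partition_rank_def if_False)
    also have "\<dots> \<longleftrightarrow> Max (set_mset p) \<le> size p + r + 2" by linarith
    also have "\<dots> \<longleftrightarrow> (\<forall>x\<in>#p. x \<le> size p + r + 2)" using False by (subst Max_le_iff) auto
    finally show ?thesis by (simp add: positive_msets_def)
  qed (auto simp: rank_ext_def positive_msets_def)
  have Max_f: "Max (set_mset (?f p)) = size p + r + 1" if "p \<in> ?D" for p
    using that unfolding D by (intro Max_eqI) (fastforce simp: dec_mset_def)+
  have gf: "?g (?f p) = p" if "p \<in> ?D" for p
    using dec_mset_inverse[of p] that unfolding D Max_f[OF that] by (simp add: Let_def)
  have fD: "?f p \<in> rank_ge r" if "p \<in> ?D" for p
    using Max_f[OF that] size_dec_mset[of p]
    by (auto simp: rank_ge_def positive_msets_def partition_rank_def dec_mset_def)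
  have fg: "?f (?g q) = q \<and> ?g q \<in> ?D" if q: "q \<in> rank_ge r" for q
  proof -
    define a where "a = Max (set_mset q)"
    define t where "t = q - {#a#}"
    have ne: "q \<noteq> {#}" and pos: "0 \<notin># q" using q by (auto simp: rank_ge_def positive_msets_def)
    have "a \<in># q" unfolding a_def using ne by (intro Max_in) auto
    hence qt: "q = add_mset a t" by (simp add: t_def)
    have le: "x \<le> a" if "x \<in># t" for x using that unfolding a_def t_def
      by (intro Max_ge) (auto dest: in_diffD)
    have "int r \<le> int a - int (size q)"
      using q by (simp add: rank_ge_def partition_rank_def a_def)
    moreover have "size q = Suc (size t)" by (subst qt) simp
    \<comment> \<open>This makes the truncated subtractions in \<open>?g\<close> exact.\<close>
    ultimately have sz: "size t + r + 1 \<le> a" by linarith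
    have g: "?g q = image_mset Suc t + replicate_mset (a - (r + 1) - size t) 1"
      by (simp add: Let_def a_def t_def)
    have size_g: "size (?g q) + r + 1 = a" unfolding g using sz by simp
    have "?f (?g q) = add_mset a t"
      unfolding size_g unfolding g using pos qt by (subst dec_mset_Suc_replicate) auto
    moreover have "0 \<notin># ?g q \<and> (\<forall>x\<in>#?g q. x \<le> size (?g q) + r + 2)"
    proof -
      have "x \<noteq> 0 \<and> x \<le> Suc a" if "x \<in># ?g q" for x
        using that le sz unfolding g by (auto split: if_splits)
      moreover have "size (?g q) + r + 2 = Suc a" using size_g by simp
      ultimately show ?thesis by metis
    qed
    ultimately show ?thesis unfolding D qt[symmetric] by blast
  qed
  have "bij_betw ?f ?D (rank_ge r)"
    by (rule bij_betw_byWitness[where f' = ?g]) (use gf fD fg in blast)+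
  hence inj: "inj_on ?f ?D" and im: "rank_ge r = ?f ` ?D" by (simp_all only: bij_betw_def)
  show ?thesis unfolding im
  proof (rule mset_gf_shift[OF inj])
    fix p assume "p \<in> ?D"
    thus "\<Sum>\<^sub># (?f p) = \<Sum>\<^sub># p + (r + 1)"
      using sum_dec_mset[of p] unfolding D by simp
  qed
qed

text \<open>The domain of Dyson's map is the complement of \<open>rank_ge (r + 3)\<close>; it
  contains the empty partition, whose \<open>rank_ext\<close> is 0.\<close>

lemma mset_gf_rank_ge:
  "mset_gf (rank_ge r) = fps_X ^ (r + 1) * (mset_gf positive_msets - mset_gf (rank_ge (r + 3)))"
proof -
  have "mset_gf positive_msets =
      (mset_gf (rank_ge (r + 3)) + mset_gf {p \<in> positive_msets. rank_ext p < int (r + 3)} :: 'a fps)"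
    by (rule mset_gf_Un[OF finite_levels_positive]) (auto simp: rank_ge_def rank_ext_def)
  thus ?thesis unfolding mset_gf_rank_ge_shift[of r] by simp
qed

section \<open>The coefficient of \<open>w^m\<close> on the rank side\<close>

definition rank_triple :: "int \<Rightarrow> nat \<Rightarrow> int" where
  "rank_triple m n = int (rank_count (3 * m) n + rank_count (3 * m + 1) n + rank_count (3 * m - 1) n)"

lemma rank_triple_eq:
  "rank_triple m n = int (card {p \<in> partitions n. \<bar>rank_ext p - 3 * m\<bar> \<le> 1})"
proof -
  let ?A = "\<lambda>i. {p \<in> partitions n. rank_ext p = i}"
  have "{p \<in> partitions n. \<bar>rank_ext p - 3 * m\<bar> \<le> 1} = (?A (3 * m) \<union> ?A (3 * m + 1)) \<union> ?A (3 * m - 1)"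
    by auto
  moreover have "card \<dots> = card (?A (3 * m) \<union> ?A (3 * m + 1)) + card (?A (3 * m - 1))"
    by (rule card_Un_disjoint) (auto simp: finite_partitions)
  moreover have "card (?A (3 * m) \<union> ?A (3 * m + 1)) = card (?A (3 * m)) + card (?A (3 * m + 1))"
    by (rule card_Un_disjoint) (auto simp: finite_partitions)
  ultimately show ?thesis by (simp add: rank_triple_def rank_count_eq)
qed

lemma rank_triple_uminus: "rank_triple (- m) n = rank_triple m n"
proof -
  have "\<bar>- i - 3 * m\<bar> = \<bar>i - 3 * - m\<bar>" for i :: int by simp
  thus ?thesis
    using card_rank_reflect[of n "\<lambda>i. \<bar>i - 3 * m\<bar> \<le> 1"] by (simp add: rank_triple_eq)
qed

text \<open>The ranks within 1 of \<open>3 * Suc m\<close> run from \<open>3 * m + 2\<close> up to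
  one below \<open>3 * Suc m + 2\<close>.\<close>

lemma rank_triple_Suc:
  "Abs_fps (rank_triple (int (Suc m))) =
     mset_gf (rank_ge (3 * m + 2)) - mset_gf (rank_ge (3 * Suc m + 2))"
proof -
  have "mset_gf (rank_ge (3 * m + 2)) = (mset_gf (rank_ge (3 * Suc m + 2)) +
      mset_gf {p \<in> positive_msets. \<bar>rank_ext p - 3 * int (Suc m)\<bar> \<le> 1} :: int fps)"
  proof (rule mset_gf_Un)
    show "finite_levels (rank_ge (3 * m + 2))"
      by (rule finite_levels_subset[OF finite_levels_positive]) (auto simp: rank_ge_def)
  qed (auto simp: rank_ge_def rank_ext_def)
  moreover have "Abs_fps (rank_triple (int (Suc m))) =
      mset_gf {p \<in> positive_msets. \<bar>rank_ext p - 3 * int (Suc m)\<bar> \<le> 1}"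
    by (rule fps_ext) (simp add: mset_gf_nth rank_triple_eq partitions_eq conj_ac)
  ultimately show ?thesis by simp
qed

text \<open>The ranks outside the window form two half-lines, which reflection shows to be equally
  populated.\<close>

lemma rank_triple_0:
  "Abs_fps (rank_triple 0) = mset_gf positive_msets - 2 * mset_gf (rank_ge 2)"
proof (rule fps_ext)
  fix n
  let ?A = "{p \<in> partitions n. \<bar>rank_ext p\<bar> \<le> 1}"
  let ?B = "{p \<in> partitions n. rank_ext p \<ge> 2}"
  let ?C = "{p \<in> partitions n. - rank_ext p \<ge> 2}"
  have "card (partitions n) = card ((?A \<union> ?B) \<union> ?C)"
    by (rule arg_cong[where f = card]) auto
  moreover have "card ((?A \<union> ?B) \<union> ?C) = card (?A \<union> ?B) + card ?C"
    by (rule card_Un_disjoint) (auto simp: finite_partitions)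
  moreover have "card (?A \<union> ?B) = card ?A + card ?B"
    by (rule card_Un_disjoint) (auto simp: finite_partitions)
  moreover have "card ?C = card ?B" by (rule card_rank_reflect[symmetric])
  moreover have "?B = {p \<in> rank_ge 2. \<Sum>\<^sub># p = n}"
    by (auto simp: rank_ge_def rank_ext_def partitions_eq split: if_splits)
  ultimately have "int (card (partitions n)) = int (card ?A) + 2 * int (card {p \<in> rank_ge 2. \<Sum>\<^sub># p = n})"
    by simp
  thus "fps_nth (Abs_fps (rank_triple 0)) n =
      fps_nth (mset_gf positive_msets - 2 * mset_gf (rank_ge 2)) n"
    by (simp add: rank_triple_eq mset_gf_nth partitions_eq numeral_fps_const fps_mult_left_const_nth)
qed

section \<open>The crank\<close>

abbreviation sized_gf :: "nat \<Rightarrow> int fps" where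
  "sized_gf j \<equiv> mset_gf (sized_msets j)"

lemma sized_gf_pred: "sized_gf j = (1 - fps_X ^ Suc j) * sized_gf (Suc j)"
  by (rule mset_gf_sized[symmetric])

text \<open>Both sides are \<open>1 / ((1-q^2) ... (1-q^(k+1)))\<close>: the factor
  \<open>1 - q\<close> cancels the contribution of ones in \<open>1 / (q;q)_(k+1)\<close>.\<close>

lemma mset_gf_parts_in_2: "mset_gf (parts_in 2 (Suc k)) = (1 - fps_X) * sized_gf (Suc k)"
proof (induction k)
  case 0
  have "parts_in 2 (Suc 0) = {s. s = {#}}" by (auto simp: parts_in_def)
  thus ?case using mset_gf_sized[of 0, where ?'a = int] mset_gf_empty_mset
    by (simp add: mset_gf_sized_0)
next
  case (Suc k)
  let ?u = "1 - fps_X ^ Suc (Suc k) :: int fps"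
  have "?u * mset_gf (parts_in 2 (Suc (Suc k))) = (1 - fps_X) * sized_gf (Suc k)"
    using mset_gf_parts_in[of 2 "Suc (Suc k)", where ?'a = int] Suc.IH by simp
  also have "\<dots> = ?u * ((1 - fps_X) * sized_gf (Suc (Suc k)))"
    by (subst sized_gf_pred) (simp only: mult_ac)
  finally have "?u * mset_gf (parts_in 2 (Suc (Suc k))) = \<dots>" .
  moreover have "?u \<noteq> 0"
  proof
    assume "?u = 0"
    hence "fps_nth ?u 0 = 0" by simp
    thus False by simp
  qed
  ultimately show ?case by (rule mult_left_cancel[THEN iffD1, rotated])
qed

text \<open>Using the largest part as first component when there are no ones makes the crank the
  difference of the components in both cases.\<close>

definition crank_type :: "nat multiset \<Rightarrow> nat \<times> nat" where
  "crank_type p = (let k = count p 1 in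
     (if k = 0 then Max (set_mset p) else size (filter_mset (\<lambda>x. k < x) p), k))"

lemma partition_crank_eq:
  "partition_crank p = int (fst (crank_type p)) - int (snd (crank_type p))"
proof (cases "count p 1 = 0")
  case True
  show ?thesis
    by (simp only: partition_crank_def crank_type_def Let_def True if_True fst_conv snd_conv
        of_nat_0 diff_0_right simp_thms)
next
  case False
  thus ?thesis by (simp only: partition_crank_def crank_type_def Let_def if_False fst_conv snd_conv)
qed

definition crank_term :: "nat \<Rightarrow> nat \<Rightarrow> int fps" where
  "crank_term j k = (1 - fps_X) * fps_X ^ (j * k + j + k) * sized_gf j * sized_gf k"

definition typed_msets :: "nat \<Rightarrow> nat \<Rightarrow> nat multiset set" where
  "typed_msets j k = {p \<in> positive_msets. p \<noteq> {#} \<and> crank_type p = (j, k)}"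

lemma crank_term_commute: "crank_term j k = crank_term k j"
  by (simp add: crank_term_def algebra_simps)

lemma crank_term_nth_eq_0:
  assumes "n < j * k + j + k"
  shows "fps_nth (crank_term j k) n = 0"
proof -
  have "crank_term j k = fps_X ^ (j * k + j + k) * ((1 - fps_X) * sized_gf j * sized_gf k)"
    by (simp only: crank_term_def mult_ac)
  thus ?thesis using assms by (simp only: fps_X_power_mult_nth if_True)
qed

text \<open>With \<open>K = Suc k\<close>, such a partition consists of \<open>K\<close> ones, parts
  between 2 and \<open>K\<close>, and \<open>j\<close> parts above \<open>K\<close>. Lowering the
  latter by \<open>K + 1\<close> leaves a member of \<open>sized_msets j\<close>; the removed weight
  is \<open>K + j * Suc K\<close>.\<close>

lemma mset_gf_typed_msets_Suc: "mset_gf (typed_msets j (Suc k)) = crank_term j (Suc k)"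
proof -
  define K where "K = Suc k"
  let ?h = "\<lambda>(b, s). replicate_mset K 1 + b + image_mset (\<lambda>x. x + Suc K) s"
  \<comment> \<open>The components are read off the glued multiset by filters, which yields both its
    type and the injectivity of \<open>?h\<close>.\<close>
  have small: "filter_mset (\<lambda>x. K < x) (?h (b, s)) = image_mset (\<lambda>x. x + Suc K) s"
      "filter_mset (\<lambda>x. 1 < x \<and> x \<le> K) (?h (b, s)) = b"
      "count (?h (b, s)) 1 = K"
    if "b \<in> parts_in 2 K" for b s
  proof -
    have b: "2 \<le> x \<and> x \<le> K" if "x \<in># b" for x
      using that \<open>b \<in> parts_in 2 K\<close> by (auto simp: parts_in_def)
    have 1: "filter_mset (\<lambda>x. K < x) b = {#}" using b by fastforce
    have b_mid: "filter_mset (\<lambda>x. 1 < x \<and> x \<le> K) b = b"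
    proof (rule multiset_eqI)
      fix x
      show "count (filter_mset (\<lambda>x. 1 < x \<and> x \<le> K) b) x = count b x"
        using b[of x] by (cases "x \<in># b") (simp_all add: not_in_iff)
    qed
    have 2: "filter_mset (\<lambda>x. K < x) (image_mset (\<lambda>x. x + Suc K) s) = image_mset (\<lambda>x. x + Suc K) s"
      "filter_mset (\<lambda>x. 1 < x \<and> x \<le> K) (image_mset (\<lambda>x. x + Suc K) s) = {#}"
      by (induction s) auto
    have 3: "filter_mset (\<lambda>x. K < x) (replicate_mset K 1) = {#}"
      "filter_mset (\<lambda>x. 1 < x \<and> x \<le> K) (replicate_mset K (1::nat)) = {#}"
      by (auto simp: filter_mset_eq_mempty_iff K_def)
    show "filter_mset (\<lambda>x. K < x) (?h (b, s)) = image_mset (\<lambda>x. x + Suc K) s"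
      "filter_mset (\<lambda>x. 1 < x \<and> x \<le> K) (?h (b, s)) = b"
      by (simp_all only: prod.case filter_union_mset 1 b_mid 2 3 empty_neutral)
    have "1 \<notin># b" "1 \<notin># image_mset (\<lambda>x. x + Suc K) s" using b[of 1] by (auto simp: K_def)
    hence "count b 1 = 0" "count (image_mset (\<lambda>x. x + Suc K) s) 1 = 0" by (simp_all only: not_in_iff)
    thus "count (?h (b, s)) 1 = K"
      by (simp only: prod.case count_union count_replicate_mset simp_thms if_True add_0_right)
  qed
  have "typed_msets j K = ?h ` (parts_in 2 K \<times> sized_msets j)"
  proof (intro equalityI subsetI)
    fix p assume p: "p \<in> typed_msets j K"
    hence pos: "0 \<notin># p" and cnt: "count p 1 = K" and sz: "size (filter_mset (\<lambda>x. K < x) p) = j"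
      by (auto simp: typed_msets_def positive_msets_def crank_type_def Let_def K_def)
    define b where "b = filter_mset (\<lambda>x. 1 < x \<and> x \<le> K) p"
    define c where "c = filter_mset (\<lambda>x. K < x) p"
    define s where "s = image_mset (\<lambda>x. x - Suc K) c"
    have "image_mset (\<lambda>x. x + Suc K) s = image_mset (\<lambda>x. x) c"
      unfolding s_def multiset.map_comp by (rule image_mset_cong) (auto simp: c_def)
    hence c: "image_mset (\<lambda>x. x + Suc K) s = c" by simp
    have "p = replicate_mset K 1 + b + c"
    proof (rule multiset_eqI)
      fix x
      have "count p 0 = 0" using pos by (simp add: not_in_iff)
      thus "count p x = count (replicate_mset K 1 + b + c) x"
        using cnt by (cases "x = 0"; cases "x = 1") (auto simp: b_def c_def K_def)
    qed
    hence "p = ?h (b, s)" by (simp only: prod.case c)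
    moreover have "b \<in> parts_in 2 K" by (auto simp: b_def parts_in_def)
    moreover have "s \<in> sized_msets j"
      using sz by (simp add: sized_msets_def s_def c_def)
    ultimately show "p \<in> ?h ` (parts_in 2 K \<times> sized_msets j)" by blast
  next
    fix p assume "p \<in> ?h ` (parts_in 2 K \<times> sized_msets j)"
    then obtain b s where b: "b \<in> parts_in 2 K" and s: "s \<in> sized_msets j" and p: "p = ?h (b, s)"
      by blast
    have "crank_type p = (j, K)"
      unfolding crank_type_def p Let_def small[OF b] using s by (simp add: K_def sized_msets_def)
    moreover have "p \<noteq> {#}" "0 \<notin># p" using b by (auto simp: p K_def parts_in_def)
    ultimately show "p \<in> typed_msets j K" by (simp add: typed_msets_def positive_msets_def)
  qed
  also have "mset_gf (?h ` (parts_in 2 K \<times> sized_msets j)) =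
      (fps_X ^ (K + j * Suc K) * mset_gf (parts_in 2 K) * mset_gf (sized_msets j) :: int fps)"
  proof (rule mset_gf_times)
    show "inj_on ?h (parts_in 2 K \<times> sized_msets j)"
    proof (rule inj_onI)
      fix u v assume u: "u \<in> parts_in 2 K \<times> sized_msets j" and v: "v \<in> parts_in 2 K \<times> sized_msets j"
        and eq: "?h u = ?h v"
      obtain b s where [simp]: "u = (b, s)" by (cases u)
      obtain b' s' where [simp]: "v = (b', s')" by (cases v)
      have eq': "?h (b, s) = ?h (b', s')" using eq by simp
      have bb: "b \<in> parts_in 2 K" "b' \<in> parts_in 2 K" using u v by auto
      have "b = b'" using small(2)[OF bb(1), of s] small(2)[OF bb(2), of s'] unfolding eq' by simp
      moreover have "image_mset (\<lambda>x. x + Suc K) s = image_mset (\<lambda>x. x + Suc K) s'"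
        using small(1)[OF bb(1), of s] small(1)[OF bb(2), of s'] unfolding eq' by simp
      hence "s = s'"
        by (rule multiset.inj_map_strong[rotated]) simp
      ultimately show "u = v" by simp
    qed
    fix b s assume "s \<in> sized_msets j"
    thus "\<Sum>\<^sub># (?h (b, s)) = \<Sum>\<^sub># b + \<Sum>\<^sub># s + (K + j * Suc K)"
      using sum_mset_image_add[of "Suc K" s] by (simp add: sized_msets_def)
  qed (simp_all add: finite_levels_parts_in finite_levels_sized)
  also have "\<dots> = crank_term j K"
    by (simp add: K_def mset_gf_parts_in_2 crank_term_def algebra_simps)
  finally show ?thesis by (simp add: K_def)
qed

text \<open>Without ones, removing one copy of the largest part \<open>j\<close> leaves arbitrary
  parts between 2 and \<open>j\<close>.\<close>

lemma mset_gf_typed_msets_0: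
  assumes "2 \<le> j"
  shows "mset_gf (typed_msets j 0) = crank_term j 0"
proof -
  have "typed_msets j 0 = add_mset j ` parts_in 2 j"
  proof (intro equalityI subsetI)
    fix p assume "p \<in> typed_msets j 0"
    hence pos: "0 \<notin># p" and ne: "p \<noteq> {#}" and no1: "1 \<notin># p" and M: "Max (set_mset p) = j"
      by (auto simp: typed_msets_def positive_msets_def crank_type_def Let_def not_in_iff
          split: if_splits)
    have "j \<in># p" using Max_in[of "set_mset p"] ne M by simp
    then obtain t where t: "p = add_mset j t" by (metis insert_DiffM)
    have "x \<in> {2..j}" if "x \<in># p" for x
    proof -
      have "x \<le> j" using Max_ge[of "set_mset p" x] that M by simp
      moreover have "x \<noteq> 0" "x \<noteq> 1" using that pos no1 by metis+
      ultimately show ?thesis by simp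
    qed
    hence "t \<in> parts_in 2 j" using t by (auto simp: parts_in_def)
    with t show "p \<in> add_mset j ` parts_in 2 j" by blast
  next
    fix p assume "p \<in> add_mset j ` parts_in 2 j"
    then obtain t where t: "p = add_mset j t" "t \<in> parts_in 2 j" by blast
    hence x: "2 \<le> x \<and> x \<le> j" if "x \<in># p" for x using that assms by (auto simp: parts_in_def)
    hence "1 \<notin># p" "0 \<notin># p" by fastforce+
    moreover have "Max (set_mset p) = j" using x t(1) by (intro Max_eqI) auto
    ultimately show "p \<in> typed_msets j 0"
      using t(1) by (simp add: typed_msets_def positive_msets_def crank_type_def not_in_iff)
  qed
  also have "mset_gf (add_mset j ` parts_in 2 j) = (fps_X ^ j * mset_gf (parts_in 2 j) :: int fps)"
    by (rule mset_gf_shift) (auto simp: inj_on_def)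
  also have "mset_gf (parts_in 2 j) = (1 - fps_X) * sized_gf j"
    using mset_gf_parts_in_2[of "j - 1"] assms by simp
  also have "fps_X ^ j * \<dots> = crank_term j 0"
    by (simp add: crank_term_def mset_gf_sized_0 mult_ac)
  finally show ?thesis .
qed

lemma crank_term_0_0: "crank_term 0 0 = 1 - fps_X"
  by (simp add: crank_term_def mset_gf_sized_0)

lemma crank_term_1_0: "crank_term 1 0 = fps_X"
proof -
  have "crank_term 1 0 = fps_X * ((1 - fps_X ^ Suc 0) * sized_gf (Suc 0))"
    by (simp add: crank_term_def mset_gf_sized_0 algebra_simps)
  thus ?thesis by (simp only: mset_gf_sized mset_gf_sized_0 mult_1_right)
qed

text \<open>The crank conventions at \<open>n \<le> 1\<close> are exactly what makes the terms
  \<open>(j, k) = (0, 0), (1, 0)\<close>, which no partition realises, come out right.\<close>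

lemma card_typed_msets:
  assumes "2 \<le> n"
  shows "int (card {p \<in> typed_msets j k. \<Sum>\<^sub># p = n}) = fps_nth (crank_term j k) n"
proof (cases "k = 0 \<and> j < 2")
  case True
  \<comment> \<open>A nonempty partition without ones has largest part at least 2.\<close>
  have "p \<notin> typed_msets j k" for p
  proof
    assume "p \<in> typed_msets j k"
    hence "0 \<notin># p" "p \<noteq> {#}" "1 \<notin># p" "Max (set_mset p) = j"
      using True by (auto simp: typed_msets_def positive_msets_def crank_type_def Let_def not_in_iff
          split: if_splits)
    moreover from this have "j \<in># p" using Max_in[of "set_mset p"] by simp
    moreover have "j = 0 \<or> j = 1" using True by linarith
    ultimately show False by metis
  qed
  moreover have "fps_nth (crank_term j k) n = 0"
  proof -
    have "j = 0 \<or> j = 1" using True by linarith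
    thus ?thesis using True assms crank_term_0_0 crank_term_1_0 by (auto simp: fps_X_def)
  qed
  ultimately show ?thesis by simp
next
  case False
  have "mset_gf (typed_msets j k) = crank_term j k"
  proof (cases k)
    case 0
    with False show ?thesis by (simp add: mset_gf_typed_msets_0)
  qed (simp add: mset_gf_typed_msets_Suc)
  hence "fps_nth (mset_gf (typed_msets j k)) n = fps_nth (crank_term j k) n" by simp
  thus ?thesis by (simp add: mset_gf_nth)
qed

lemma crank_type_bounds:
  assumes "p \<in> partitions n" "n > 0"
  shows "crank_type p \<in> {..n} \<times> {..n}"
proof -
  have p: "0 \<notin># p" "p \<noteq> {#}" "\<Sum>\<^sub># p = n" using assms by (auto simp: partitions_def)
  hence "Max (set_mset p) \<in># p" by (intro Max_in) simp_all
  hence "Max (set_mset p) \<le> n" using member_le_sum_mset p(3) by blast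
  moreover have "size p \<le> n" using size_le_sum_mset p by blast
  moreover have "count p 1 \<le> size p" by (rule count_le_size)
  moreover have "size (filter_mset (\<lambda>x. count p 1 < x) p) \<le> n"
    by (rule order_trans[OF size_mset_mono \<open>size p \<le> n\<close>]) simp
  ultimately show ?thesis by (simp add: crank_type_def Let_def)
qed

text \<open>For \<open>n \<ge> 2\<close> the partitions are grouped by \<open>crank_type\<close>.
  The conventions at \<open>n \<le> 1\<close> are matched by \<open>crank_term 0 0 = 1 - q\<close>
  and by \<open>q\<close> as the term for \<open>(1, 0)\<close> and \<open>(0, 1)\<close>.\<close>

lemma crank_count_eq_sum:
  "crank_count m n = (\<Sum>(j, k)\<in>{..n} \<times> {..n}. if int j - int k = m then fps_nth (crank_term j k) n else 0)"
proof -
  consider "n = 0" | "n = 1" | "2 \<le> n" by linarith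
  thus ?thesis
  proof cases
    case 1
    thus ?thesis by (simp add: crank_count_def crank_term_0_0)
  next
    case 2
    have "crank_term 0 1 = fps_X" using crank_term_1_0 crank_term_commute by metis
    \<comment> \<open>This term starts at \<open>q^3\<close>.\<close>
    moreover have "fps_nth (crank_term 1 1) 1 = 0" by (rule crank_term_nth_eq_0) simp
    moreover have "{..1::nat} = {0, 1}" by auto
    ultimately show ?thesis
      using 2 crank_term_1_0
      by (simp add: crank_count_def crank_term_0_0 sum.cartesian_product[symmetric])
  next
    case 3
    let ?T = "{..n} \<times> {..n}"
    let ?S = "{p \<in> partitions n. partition_crank p = m}"
    have "int (card ?S) = (\<Sum>p\<in>?S. 1)" by simp
    also have "\<dots> = (\<Sum>y\<in>?T. \<Sum>p\<in>{p \<in> ?S. crank_type p = y}. 1)"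
      by (rule sum.group[where g = crank_type, symmetric])
         (simp_all add: finite_partitions, use crank_type_bounds 3 in fastforce)
    also have "\<dots> = (\<Sum>(j, k)\<in>?T. if int j - int k = m then fps_nth (crank_term j k) n else 0)"
    proof (intro sum.cong refl, clarify)
      fix j k
      have "p \<noteq> {#}" if "\<Sum>\<^sub># p = n" for p using that 3 by auto
      hence "{p \<in> ?S. crank_type p = (j, k)} =
          (if int j - int k = m then {p \<in> typed_msets j k. \<Sum>\<^sub># p = n} else {})"
        by (auto simp: partitions_eq typed_msets_def partition_crank_eq)
      thus "(\<Sum>p\<in>{p \<in> ?S. crank_type p = (j, k)}. 1) =
          (if int j - int k = m then fps_nth (crank_term j k) n else 0)"
        using card_typed_msets[OF 3, of j k] by simp
    qed
    finally show ?thesis using 3 by (simp add: crank_count_def)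
  qed
qed

text \<open>Exchanging \<open>j\<close> and \<open>k\<close> fixes \<open>crank_term\<close> and
  negates \<open>j - k\<close>.\<close>

lemma crank_count_uminus: "crank_count (- m) n = crank_count m n"
proof -
  have "crank_count (- m) n = (\<Sum>j\<le>n. \<Sum>k\<le>n. if int j - int k = - m then fps_nth (crank_term j k) n else 0)"
    by (simp add: crank_count_eq_sum sum.cartesian_product)
  also have "\<dots> = (\<Sum>k\<le>n. \<Sum>j\<le>n. if int k - int j = m then fps_nth (crank_term k j) n else 0)"
  proof (subst sum.swap, rule sum.cong[OF refl], rule sum.cong[OF refl])
    fix k j
    have "(int j - int k = - m) = (int k - int j = m)" by linarith
    thus "(if int j - int k = - m then fps_nth (crank_term j k) n else 0) =
        (if int k - int j = m then fps_nth (crank_term k j) n else 0)"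
      by (simp only: crank_term_commute[of j k])
  qed
  finally show ?thesis by (simp add: crank_count_eq_sum sum.cartesian_product)
qed

section \<open>Three-term recurrence for the crank\<close>

lemma crank_count_eq_diagonal_sum:
  assumes "n \<le> N"
  shows "crank_count (int m) n = fps_nth (\<Sum>k\<le>N. crank_term (m + k) k) n"
proof -
  have z: "fps_nth (crank_term (m + k) k) n = 0" if "n < m + k" for k
    using that by (intro crank_term_nth_eq_0) simp
  have "crank_count (int m) n =
      (\<Sum>k\<le>n. \<Sum>j\<le>n. if j = m + k then fps_nth (crank_term j k) n else 0)"
  proof -
    have "crank_count (int m) n = (\<Sum>j\<le>n. \<Sum>k\<le>n. if int j - int k = int m then fps_nth (crank_term j k) n else 0)"
      by (simp add: crank_count_eq_sum sum.cartesian_product)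
    also have "\<dots> = (\<Sum>k\<le>n. \<Sum>j\<le>n. if j = m + k then fps_nth (crank_term j k) n else 0)"
      by (subst sum.swap, rule sum.cong[OF refl], rule sum.cong[OF refl]) auto
    finally show ?thesis .
  qed
  also have "\<dots> = (\<Sum>k\<le>n. fps_nth (crank_term (m + k) k) n)"
    by (rule sum.cong[OF refl]) (auto simp: z)
  \<comment> \<open>Terms with \<open>k > n\<close> start beyond \<open>q^n\<close>. The freedom in
    \<open>N\<close> lets one truncated sum serve several coefficients.\<close>
  also have "\<dots> = (\<Sum>k\<le>N. fps_nth (crank_term (m + k) k) n)"
    by (rule sum.mono_neutral_left) (use assms z in auto)
  finally show ?thesis by (simp add: fps_sum_nth)
qed

lemma crank_count_eq_0:
  assumes "n < m"
  shows "crank_count (int m) n = 0"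
  unfolding crank_count_eq_diagonal_sum[OF order_refl] fps_sum_nth
  by (rule sum.neutral) (use assms in \<open>auto intro!: crank_term_nth_eq_0\<close>)

lemma crank_term_recurrence_0:
  "(1 - fps_X ^ Suc m) * crank_term (Suc m) 0 = fps_X * crank_term m 0"
  unfolding crank_term_def sized_gf_pred[of m] by (simp add: mset_gf_sized_0 algebra_simps)

text \<open>All three terms are multiples of \<open>c\<close>, with factors
  \<open>q^(e+k+1) - q^(e+j)\<close>, \<open>q^e - q^(e+j)\<close> and
  \<open>q^e - q^(e+k+1)\<close>; the first is the difference of the other two.\<close>

lemma crank_term_recurrence:
  fixes m k :: nat
  defines "j \<equiv> m + k + 2"
  shows "(1 - fps_X ^ Suc m) * crank_term j (Suc k) =
    fps_X * crank_term (j - 1) (Suc k) - fps_X ^ (m + 2) * crank_term j k"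
proof -
  let ?X = "fps_X :: int fps"
  define c where "c = (1 - ?X) * sized_gf j * sized_gf (Suc k)"
  have a: "sized_gf (j - 1) = (1 - ?X ^ j) * sized_gf j"
    using sized_gf_pred[of "j - 1"] by (simp add: j_def)
  define e where "e = j * Suc k + j"
  have "crank_term j (Suc k) = ?X ^ (e + Suc k) * c"
    by (simp only: crank_term_def c_def e_def mult_ac)
  hence 1: "(1 - ?X ^ Suc m) * crank_term j (Suc k) = (?X ^ (e + Suc k) - ?X ^ (e + Suc k + Suc m)) * c"
    by (simp add: power_add algebra_simps)
  have "fps_X * crank_term (j - 1) (Suc k) =
      ?X ^ Suc ((j - 1) * Suc k + (j - 1) + Suc k) * ((1 - ?X ^ j) * c)"
    by (simp only: crank_term_def c_def a mult_ac power_Suc)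
  moreover have "Suc ((j - 1) * Suc k + (j - 1) + Suc k) = e" by (simp add: e_def j_def)
  ultimately have "fps_X * crank_term (j - 1) (Suc k) = ?X ^ e * ((1 - ?X ^ j) * c)"
    by (simp only:)
  also have "\<dots> = (?X ^ e - ?X ^ (e + j)) * c" by (simp add: power_add algebra_simps)
  finally have 2: "fps_X * crank_term (j - 1) (Suc k) = (?X ^ e - ?X ^ (e + j)) * c" .
  have "?X ^ (m + 2) * crank_term j k = ?X ^ (m + 2 + (j * k + j + k)) * ((1 - ?X ^ Suc k) * c)"
    unfolding crank_term_def sized_gf_pred[of k] by (simp only: c_def mult_ac power_add)
  moreover have "m + 2 + (j * k + j + k) = e" by (simp add: e_def j_def)
  ultimately have "?X ^ (m + 2) * crank_term j k = ?X ^ e * ((1 - ?X ^ Suc k) * c)"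
    by (simp only:)
  also have "\<dots> = (?X ^ e - ?X ^ (e + Suc k)) * c" by (simp add: power_add algebra_simps)
  finally have 3: "?X ^ (m + 2) * crank_term j k = (?X ^ e - ?X ^ (e + Suc k)) * c" .
  have 4: "e + Suc k + Suc m = e + j" by (simp add: j_def)
  show ?thesis unfolding 1 2 3 4 by (simp only: left_diff_distrib) simp
qed

text \<open>Splitting off \<open>k = 0\<close> matches index \<open>Suc k\<close> on the left with
  \<open>k\<close> in the subtracted sum, hence its shorter range.\<close>

lemma diagonal_sum_recurrence:
  "(1 - fps_X ^ Suc m) * (\<Sum>k\<le>Suc N. crank_term (Suc m + k) k) =
     fps_X * (\<Sum>k\<le>Suc N. crank_term (m + k) k)
       - fps_X ^ (m + 2) * (\<Sum>k\<le>N. crank_term (m + 2 + k) k)"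
proof -
  let ?u = "1 - fps_X ^ Suc m :: int fps"
  have "?u * (\<Sum>k\<le>Suc N. crank_term (Suc m + k) k) =
      ?u * crank_term (Suc m) 0 + (\<Sum>k\<le>N. ?u * crank_term (m + k + 2) (Suc k))"
    by (subst sum.atMost_Suc_shift) (simp add: distrib_left sum_distrib_left)
  also have "\<dots> = fps_X * crank_term m 0 + (\<Sum>k\<le>N. fps_X * crank_term (m + Suc k) (Suc k)
       - fps_X ^ (m + 2) * crank_term (m + 2 + k) k)"
    unfolding crank_term_recurrence_0 crank_term_recurrence by (simp add: ac_simps)
  also have "\<dots> = fps_X * (crank_term m 0 + (\<Sum>k\<le>N. crank_term (m + Suc k) (Suc k)))
       - fps_X ^ (m + 2) * (\<Sum>k\<le>N. crank_term (m + 2 + k) k)"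
    by (simp add: sum_subtractf sum_distrib_left distrib_left)
  also have "crank_term m 0 + (\<Sum>k\<le>N. crank_term (m + Suc k) (Suc k)) = (\<Sum>k\<le>Suc N. crank_term (m + k) k)"
    by (subst sum.atMost_Suc_shift) simp
  finally show ?thesis .
qed

definition crank_gf :: "nat \<Rightarrow> int fps" where
  "crank_gf m = Abs_fps (crank_count (int m))"

lemma crank_gf_recurrence:
  "(1 - fps_X ^ Suc m) * crank_gf (Suc m) = fps_X * crank_gf m - fps_X ^ (m + 2) * crank_gf (m + 2)"
proof (rule fps_ext)
  fix n
  let ?S = "\<lambda>N m. \<Sum>k\<le>N. crank_term (m + k) k"
  have M: "fps_nth (crank_gf m) i = fps_nth (?S N m) i" if "i \<le> N" for m i N
    by (simp only: crank_gf_def fps_nth_Abs_fps crank_count_eq_diagonal_sum[OF that])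
  \<comment> \<open>Only coefficients of index at most \<open>n\<close> enter, so the truncations at
    \<open>Suc n\<close> and \<open>n\<close> are exact.\<close>
  have "fps_nth ((1 - fps_X ^ Suc m) * crank_gf (Suc m)) n =
      fps_nth ((1 - fps_X ^ Suc m) * ?S (Suc n) (Suc m)) n"
    unfolding left_diff_distrib mult_1_left fps_sub_nth fps_X_power_mult_nth
    by (simp only: M[of _ "Suc n"] le_SucI diff_le_self order_refl)
  also have "\<dots> = fps_nth (fps_X ^ 1 * ?S (Suc n) m - fps_X ^ (m + 2) * ?S n (m + 2)) n"
    by (simp only: diagonal_sum_recurrence power_one_right)
  also have "\<dots> = fps_nth (fps_X ^ 1 * crank_gf m - fps_X ^ (m + 2) * crank_gf (m + 2)) n"
    unfolding fps_sub_nth fps_X_power_mult_nth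
    by (simp only: M[where N = "Suc n" and m = m] M[where N = n and m = "m + 2"] le_SucI diff_le_self order_refl)
  finally show "fps_nth ((1 - fps_X ^ Suc m) * crank_gf (Suc m)) n =
      fps_nth (fps_X * crank_gf m - fps_X ^ (m + 2) * crank_gf (m + 2)) n"
    by (simp only: power_one_right)
qed

section \<open>Recursion for the crank tails\<close>

definition crank_ge_gf :: "nat \<Rightarrow> int fps" where
  "crank_ge_gf m = Abs_fps (\<lambda>n. \<Sum>i\<in>{m..n}. crank_count (int i) n)"

text \<open>Stopping the tail at \<open>i = n\<close> loses nothing, because
  \<open>crank_count (int i) n\<close> is 0 for \<open>i > n\<close>.\<close>

lemma crank_gf_eq: "crank_gf m = crank_ge_gf m - crank_ge_gf (Suc m)"
proof (rule fps_ext)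
  fix n
  show "fps_nth (crank_gf m) n = fps_nth (crank_ge_gf m - crank_ge_gf (Suc m)) n"
    by (cases "m \<le> n")
       (simp_all add: crank_gf_def crank_ge_gf_def sum.atLeast_Suc_atMost crank_count_eq_0)
qed

text \<open>By symmetry the second tail stands for the negative cranks, so together the tails count
  every partition once.\<close>

lemma crank_ge_gf_0: "crank_ge_gf 0 + crank_ge_gf 1 = mset_gf positive_msets"
proof (rule fps_ext)
  fix n
  have "(\<Sum>i\<in>{0..n}. crank_count (int i) n) + (\<Sum>i\<in>{1..n}. crank_count (int i) n) = int (card (partitions n))"
  proof -
    consider "n = 0" | "n = 1" | "2 \<le> n" by linarith
    thus ?thesis
    proof cases
      case 1
      thus ?thesis by (simp add: crank_count_def partitions_0)
    next
      case 2
      \<comment> \<open>The conventional values \<open>- 1 + 1 + 1\<close> add up to the single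
        partition of 1.\<close>
      have "p = {#1#}" if "p \<in> partitions 1" for p
      proof -
        have p: "0 \<notin># p" "p \<noteq> {#}" "\<Sum>\<^sub># p = 1" using that by (auto simp: partitions_def)
        then obtain x t where t: "p = add_mset x t" by (metis multiset_cases)
        with p have "x \<noteq> 0" "x + \<Sum>\<^sub># t = 1" by auto
        hence "x = 1" "\<Sum>\<^sub># t = 0" by linarith+
        moreover from this p t have "t \<in> partitions 0" by (simp add: partitions_def)
        ultimately show ?thesis using t by (simp add: partitions_0)
      qed
      moreover have "{#1#} \<in> partitions 1" by (simp add: partitions_def)
      ultimately have "partitions 1 = {{#1#}}" by blast
      with 2 show ?thesis by (simp add: crank_count_def)
    next
      case 3
      let ?A = "int ` {0..n}" and ?B = "(\<lambda>i. - int i) ` {1..n}"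
      have r: "partition_crank p \<in> ?A \<union> ?B" if "p \<in> partitions n" for p
      proof -
        have "crank_type p \<in> {..n} \<times> {..n}" using crank_type_bounds[OF that] 3 by simp
        hence b: "\<bar>partition_crank p\<bar> \<le> int n"
          unfolding partition_crank_eq by (auto simp: mem_Times_iff)
        show ?thesis
        proof (cases "partition_crank p \<ge> 0")
          case True
          with b have "partition_crank p = int (nat (partition_crank p))" "nat (partition_crank p) \<in> {0..n}"
            by auto
          thus ?thesis by blast
        next
          case False
          with b have "partition_crank p = - int (nat (- partition_crank p))" "nat (- partition_crank p) \<in> {1..n}"
            by auto
          thus ?thesis by blast
        qed
      qed
      have "int (card (partitions n)) = (\<Sum>p\<in>partitions n. 1)" by simp
      also have "\<dots> = (\<Sum>y\<in>?A \<union> ?B. \<Sum>p\<in>{p \<in> partitions n. partition_crank p = y}. 1)"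
      proof (rule sum.group[where g = partition_crank, symmetric])
        show "partition_crank ` partitions n \<subseteq> ?A \<union> ?B" using r by blast
      qed (simp_all add: finite_partitions)
      also have "\<dots> = (\<Sum>y\<in>?A \<union> ?B. crank_count y n)" using 3 by (simp add: crank_count_def)
      also have "\<dots> = (\<Sum>y\<in>?A. crank_count y n) + (\<Sum>y\<in>?B. crank_count y n)"
        by (rule sum.union_disjoint) auto
      also have "(\<Sum>y\<in>?A. crank_count y n) = (\<Sum>i\<in>{0..n}. crank_count (int i) n)"
        by (subst sum.reindex) auto
      also have "(\<Sum>y\<in>?B. crank_count y n) = (\<Sum>i\<in>{1..n}. crank_count (int i) n)"
        by (subst sum.reindex) (auto simp: inj_on_def crank_count_uminus)
      finally show ?thesis by simp
    qed
  qed
  thus "fps_nth (crank_ge_gf 0 + crank_ge_gf 1) n = fps_nth (mset_gf positive_msets) n"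
    by (simp add: crank_ge_gf_def mset_gf_nth partitions_eq)
qed

text \<open>By the three-term recurrence the left-hand side does not depend on \<open>m\<close>, and its
  subdegree tends to infinity with \<open>m\<close>.\<close>

lemma crank_ge_gf_step:
  "fps_X * crank_ge_gf m - crank_ge_gf (Suc m) + fps_X ^ Suc m * crank_gf (Suc m) = 0"
proof -
  define F where "F m = fps_X ^ 1 * crank_ge_gf m - crank_ge_gf (Suc m) + fps_X ^ Suc m * crank_gf (Suc m)" for m
  have step: "F m = F (Suc m)" for m
  proof -
    \<comment> \<open>Differences of consecutive tails are \<open>crank_gf\<close>, so this is the
      three-term recurrence.\<close>
    have "F m - F (Suc m) = fps_X * crank_gf m - fps_X ^ (m + 2) * crank_gf (m + 2)
        - (1 - fps_X ^ Suc m) * crank_gf (Suc m)"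
      unfolding F_def crank_gf_eq[of m] crank_gf_eq[of "Suc m"] by (simp add: algebra_simps)
    also have "\<dots> = 0" using crank_gf_recurrence[of m] by simp
    finally show ?thesis by simp
  qed
  have const: "F m = F (m + d)" for d by (induction d) (auto simp: step[symmetric])
  have vanish: "fps_nth (F m) n = 0" if "n < m" for m n
    unfolding F_def fps_add_nth fps_sub_nth fps_X_power_mult_nth using that
    by (simp add: crank_ge_gf_def)
  have "F m = 0"
  proof (rule fps_ext)
    fix n
    show "fps_nth (F m) n = fps_nth 0 n" using vanish[of n "m + Suc n"] const[of "Suc n"] by simp
  qed
  thus ?thesis by (simp add: F_def)
qed

text \<open>The defect \<open>D\<close> vanishes at 0 by \<open>crank_ge_gf_0\<close>, and
  \<open>crank_ge_gf_step\<close> says that \<open>D (Suc m)\<close> is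
  \<open>q * D m\<close>.\<close>

lemma crank_ge_gf_eq:
  "crank_ge_gf m = fps_X ^ m * (mset_gf positive_msets - crank_ge_gf (Suc m))"
proof -
  define D where "D m = crank_ge_gf m - fps_X ^ m * (mset_gf positive_msets - crank_ge_gf (Suc m))" for m
  have "D m = 0"
  proof (induction m)
    case 0
    show ?case using crank_ge_gf_0 by (simp add: D_def algebra_simps)
  next
    case (Suc m)
    have "fps_X * D m - D (Suc m) = 0"
      using crank_ge_gf_step[of m] unfolding D_def crank_gf_eq[of "Suc m"] by (simp add: algebra_simps)
    with Suc show ?case by simp
  qed
  thus ?thesis by (simp add: D_def)
qed

section \<open>Comparison of rank and crank\<close>

lemma fps_X_power_compose:
  assumes "0 < k"
  shows "fps_X ^ d oo fps_X ^ k = (fps_X ^ (k * d) :: 'a::idom fps)"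
proof -
  have c: "fps_nth (fps_X ^ k :: 'a fps) 0 = 0" using assms by simp
  show ?thesis
    using fps_compose_power[OF c, of fps_X d] c by (simp add: power_mult)
qed

section \<open>Euler's product for partitions\<close>

lemma prod_mset_gf_parts_in:
  "(\<Prod>j<N. 1 - fps_X ^ Suc j) * mset_gf (parts_in 1 N) = 1"
proof (induction N)
  case 0
  have "parts_in 1 0 = {s. s = {#}}" by (auto simp: parts_in_def)
  thus ?case using mset_gf_empty_mset by simp
next
  case (Suc N)
  have "(\<Prod>j<Suc N. 1 - fps_X ^ Suc j) * mset_gf (parts_in 1 (Suc N)) =
      (\<Prod>j<N. 1 - fps_X ^ Suc j :: 'a fps) * ((1 - fps_X ^ Suc N) * mset_gf (parts_in 1 (Suc N)))"
    by (simp only: prod.lessThan_Suc mult.assoc)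
  also have "\<dots> = 1" using mset_gf_parts_in[of 1 "Suc N", where ?'a = 'a] Suc.IH by simp
  finally show ?case .
qed

lemma mset_gf_parts_in_nth:
  assumes "i \<le> N"
  shows "fps_nth (mset_gf (parts_in 1 N)) i = fps_nth (mset_gf positive_msets) i"
proof -
  have "x \<in> {1..N}" if "x \<in># s" "0 \<notin># s" "\<Sum>\<^sub># s = i" for x s
  proof -
    have "x \<noteq> 0" using that by metis
    thus ?thesis using member_le_sum_mset[OF that(1)] that(3) assms by simp
  qed
  hence "{s \<in> parts_in 1 N. \<Sum>\<^sub># s = i} = {s \<in> positive_msets. \<Sum>\<^sub># s = i}"
    by (auto simp: parts_in_def positive_msets_def)
  thus ?thesis by (simp only: mset_gf_nth)
qed

text \<open>Euler's product at \<open>q^k\<close>. Up to \<open>q^n\<close> the infinite product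
  agrees with a finite one, and the partitions may be restricted to parts at most \<open>N\<close>;
  the finite identity then applies after substitution.\<close>

lemma qpoch_inf_mult_mset_gf:
  assumes "0 < k"
  shows "qpoch_inf (fps_X ^ k) (fps_X ^ k) * (mset_gf positive_msets oo fps_X ^ k) = (1 :: 'a::idom fps)"
proof (rule fps_ext)
  fix n
  let ?f = "\<lambda>j. 1 - fps_X ^ k * (fps_X ^ k) ^ j :: 'a fps"
  have c: "fps_nth (fps_X ^ k :: 'a fps) 0 = 0" using assms by simp
  have "(\<lambda>N. \<Prod>j<N. ?f j) \<longlonglongrightarrow> qpoch_inf (fps_X ^ k) (fps_X ^ k)"
    by (rule has_prod_imp_tendsto'[OF qpoch_inf_has_prod(1)[OF assms]])
  hence "\<forall>i. eventually (\<lambda>N. fps_nth (\<Prod>j<N. ?f j) i = fps_nth (qpoch_inf (fps_X ^ k) (fps_X ^ k)) i) sequentially"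
    by (rule tendsto_fps_iff[THEN iffD1])
  \<comment> \<open>One \<open>N\<close> is wanted for all coefficients up to \<open>n\<close> at
    once.\<close>
  hence "eventually (\<lambda>N. \<forall>i\<in>{..n}. fps_nth (\<Prod>j<N. ?f j) i = fps_nth (qpoch_inf (fps_X ^ k) (fps_X ^ k)) i) sequentially"
    by (intro eventually_ball_finite) auto
  moreover have "eventually (\<lambda>N. n \<le> N) sequentially" by (rule eventually_ge_at_top)
  ultimately have "eventually (\<lambda>N. n \<le> N \<and> (\<forall>i\<in>{..n}. fps_nth (\<Prod>j<N. ?f j) i = fps_nth (qpoch_inf (fps_X ^ k) (fps_X ^ k)) i)) sequentially"
    by eventually_elim blast
  then obtain N where N: "n \<le> N"
    "\<And>i. i \<le> n \<Longrightarrow> fps_nth (\<Prod>j<N. ?f j) i = fps_nth (qpoch_inf (fps_X ^ k) (fps_X ^ k)) i"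
    unfolding eventually_sequentially by (metis atMost_iff order_refl)
  let ?P = "mset_gf positive_msets oo fps_X ^ k :: 'a fps"
  let ?Q = "mset_gf (parts_in 1 N) oo fps_X ^ k :: 'a fps"
  have PQ: "fps_nth ?P i = fps_nth ?Q i" if "i \<le> n" for i
  proof -
    have "i div k \<le> N" using that N(1) div_le_dividend[of i k] by linarith
    thus ?thesis by (simp only: fps_nth_compose_X_power mset_gf_parts_in_nth)
  qed
  have f: "?f j = (1 - fps_X ^ Suc j) oo fps_X ^ k" for j
    by (simp only: fps_compose_sub_distrib fps_compose_1 fps_X_power_compose[OF assms])
       (simp add: power_mult[symmetric] power_add)
  have "fps_nth (qpoch_inf (fps_X ^ k) (fps_X ^ k) * ?P) n = fps_nth ((\<Prod>j<N. ?f j) * ?Q) n"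
    unfolding fps_mult_nth by (rule sum.cong[OF refl]) (simp add: N(2) PQ)
  also have "(\<Prod>j<N. ?f j) * ?Q = ((\<Prod>j<N. 1 - fps_X ^ Suc j) * mset_gf (parts_in 1 N)) oo fps_X ^ k"
    by (simp only: f fps_compose_mult_distrib[OF c] fps_compose_prod_distrib[OF c])
  also have "\<dots> = 1" by (simp only: prod_mset_gf_parts_in fps_compose_1)
  finally show "fps_nth (qpoch_inf (fps_X ^ k) (fps_X ^ k) * ?P) n = fps_nth 1 n" .
qed

section \<open>Equality of rank and crank tails\<close>

lemma fps_eq_0_if_shifted:
  fixes f :: "nat \<Rightarrow> 'a::comm_ring_1 fps"
  assumes "\<And>m. f m = fps_X ^ Suc (d m) * g m * f (Suc m)"
  shows "f m = 0"
proof (rule fps_ext)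
  fix n
  \<comment> \<open>Unfolding the hypothesis lowers the coefficient index by at least one but raises
    \<open>m\<close>, so the induction on \<open>n\<close> covers all \<open>m\<close> at
    once.\<close>
  have "\<forall>m. fps_nth (f m) n = 0"
  proof (induction n rule: less_induct)
    case (less n)
    show ?case
    proof
      fix m
      have "fps_nth (g m * f (Suc m)) (n - Suc (d m)) = 0" if "\<not> n < Suc (d m)"
        unfolding fps_mult_nth using that less by (intro sum.neutral) auto
      moreover have "fps_nth (f m) n = (if n < Suc (d m) then 0 else fps_nth (g m * f (Suc m)) (n - Suc (d m)))"
        by (subst assms) (simp only: mult.assoc fps_X_power_mult_nth)
      ultimately show "fps_nth (f m) n = 0" by metis
    qed
  qed
  thus "fps_nth (f m) n = fps_nth 0 n" by simp
qed

abbreviation partition_gf :: "int fps" where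
  "partition_gf \<equiv> mset_gf positive_msets"

text \<open>The bound \<open>3 * m + 2\<close> is \<open>3 * Suc m - 1\<close>, which pairs this
  rank tail with \<open>crank_ge_gf (Suc m)\<close>.\<close>

lemma rank_ge_crank_ge:
  "(partition_gf oo fps_X ^ 3) * mset_gf (rank_ge (3 * m + 2)) =
     partition_gf * (crank_ge_gf (Suc m) oo fps_X ^ 3)"
proof -
  define R where "R m = (mset_gf (rank_ge (3 * m + 2)) :: int fps)" for m
  define K where "K m = crank_ge_gf (Suc m) oo fps_X ^ 3" for m
  define D where "D m = (partition_gf oo fps_X ^ 3) * R m - partition_gf * K m" for m
  have R: "R m = fps_X ^ (3 * Suc m) * (partition_gf - R (Suc m))" for m
  proof -
    have "3 * m + 2 + 1 = 3 * Suc m" "3 * m + 2 + 3 = 3 * Suc m + 2" by simp_all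
    thus ?thesis
      using mset_gf_rank_ge[of "3 * m + 2", where ?'a = int] by (simp only: R_def)
  qed
  have c: "fps_nth (fps_X ^ 3 :: int fps) 0 = 0" by simp
  have K: "K m = fps_X ^ (3 * Suc m) * ((partition_gf oo fps_X ^ 3) - K (Suc m))" for m
  proof -
    have "K m = (fps_X ^ Suc m * (partition_gf - crank_ge_gf (Suc (Suc m)))) oo fps_X ^ 3"
      unfolding K_def by (subst crank_ge_gf_eq) (rule refl)
    thus ?thesis
      by (simp only: fps_compose_mult_distrib[OF c] fps_compose_sub_distrib
          fps_X_power_compose[OF zero_less_numeral] K_def)
  qed
  \<comment> \<open>The products of \<open>partition_gf\<close> and
    \<open>partition_gf oo fps_X ^ 3\<close> cancel, leaving a homogeneous recursion for the
    difference \<open>D\<close>.\<close>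
  have "D m = fps_X ^ Suc (3 * m + 2) * (- 1) * D (Suc m)" for m
  proof -
    have "3 * Suc m = Suc (3 * m + 2)" by simp
    hence "D m = (partition_gf oo fps_X ^ 3) * (fps_X ^ Suc (3 * m + 2) * (partition_gf - R (Suc m)))
        - partition_gf * (fps_X ^ Suc (3 * m + 2) * ((partition_gf oo fps_X ^ 3) - K (Suc m)))"
      using R[of m] K[of m] by (simp only: D_def)
    also have "\<dots> = fps_X ^ Suc (3 * m + 2) * (- 1) * D (Suc m)"
      unfolding D_def right_diff_distrib by (simp add: mult_ac)
    finally show ?thesis .
  qed
  hence "D m = 0" by (rule fps_eq_0_if_shifted)
  thus ?thesis by (simp add: D_def R_def K_def)
qed

lemma rank_triple_crank_count:
  "(partition_gf oo fps_X ^ 3) * Abs_fps (rank_triple m) =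
     partition_gf * (Abs_fps (crank_count m) oo fps_X ^ 3)"
proof -
  have Suc: "(partition_gf oo fps_X ^ 3) * Abs_fps (rank_triple (int (Suc m))) =
     partition_gf * (Abs_fps (crank_count (int (Suc m))) oo fps_X ^ 3)" for m
    unfolding rank_triple_Suc crank_gf_def[symmetric] crank_gf_eq[of "Suc m"]
      fps_compose_sub_distrib right_diff_distrib rank_ge_crank_ge by (rule refl)
  show ?thesis
  proof (cases m rule: int_cases3)
    case zero
    \<comment> \<open>The tails from 0 and from 1 have sum \<open>partition_gf\<close> and
      difference \<open>crank_gf 0\<close>.\<close>
    have "Abs_fps (crank_count 0) = partition_gf - crank_ge_gf 1 - crank_ge_gf 1"
      unfolding crank_ge_gf_0[symmetric] using crank_gf_eq[of 0] by (simp add: crank_gf_def)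
    moreover have "(partition_gf oo fps_X ^ 3) * mset_gf (rank_ge 2) =
        partition_gf * (crank_ge_gf 1 oo fps_X ^ 3)"
      using rank_ge_crank_ge[of 0] by (simp only: mult_0_right add_0_left One_nat_def)
    moreover have "Abs_fps (rank_triple 0) = partition_gf - mset_gf (rank_ge 2) - mset_gf (rank_ge 2)"
      unfolding rank_triple_0 by simp
    ultimately show ?thesis
      unfolding zero by (simp only: fps_compose_sub_distrib right_diff_distrib mult.commute)
  next
    case (pos n)
    thus ?thesis using Suc[of "n - 1"] by simp
  next
    case (neg n)
    hence "rank_triple m = rank_triple (int (Suc (n - 1)))" "crank_count m = crank_count (int (Suc (n - 1)))"
      by (auto simp: rank_triple_uminus crank_count_uminus)
    thus ?thesis using Suc[of "n - 1"] by (simp only:)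
  qed
qed

section \<open>Assembling the coefficients of \<open>w^m\<close>\<close>

lemma lookup_of_nat_times:
  "Poly_Mapping.lookup (of_nat c * p) m = int c * Poly_Mapping.lookup p m"
  for p :: "int \<Rightarrow>\<^sub>0 int"
  by (induction c) (simp_all add: distrib_right lookup_add)

text \<open>The series with coefficients \<open>c i\<close> is free of \<open>w\<close>, so
  extracting the coefficient of \<open>w^m\<close> commutes with multiplying by it.\<close>

lemma lookup_fps_mult_of_nat:
  fixes F :: "(int \<Rightarrow>\<^sub>0 int) fps"
  shows "Poly_Mapping.lookup (fps_nth (Abs_fps (\<lambda>i. of_nat (c i)) * F) n) m =
    fps_nth (Abs_fps (\<lambda>i. int (c i)) * Abs_fps (\<lambda>i. Poly_Mapping.lookup (fps_nth F i) m)) n"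
  by (simp add: fps_mult_nth Poly_Mapping.lookup_sum lookup_of_nat_times)

lemma laurent_gf_rank_crank:
  "(mset_gf positive_msets oo fps_X ^ 3) * laurent_gf rank_triple =
     mset_gf positive_msets * (laurent_gf crank_count oo fps_X ^ 3)"
proof (rule fps_ext, rule poly_mapping_eqI)
  fix n m
  define c where "c i = card {s \<in> positive_msets. \<Sum>\<^sub># s = i}" for i
  \<comment> \<open>These are the coefficients after substituting \<open>q^3\<close>.\<close>
  define c3 where "c3 i = (if 3 dvd i then c (i div 3) else 0)" for i
  have P: "mset_gf positive_msets = Abs_fps (\<lambda>i. of_nat (c i) :: 'a::comm_ring_1)"
    by (simp add: mset_gf_def c_def)
  have P3: "mset_gf positive_msets oo fps_X ^ 3 = Abs_fps (\<lambda>i. of_nat (c3 i) :: 'a::comm_ring_1)"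
    by (rule fps_ext) (simp add: fps_nth_compose_X_power P c3_def)
  have R: "Abs_fps (\<lambda>i. Poly_Mapping.lookup (fps_nth (laurent_gf rank_triple) i) m) = Abs_fps (rank_triple m)"
    using finite_rank_count_triple_support
    by (intro fps_ext) (simp add: lookup_laurent_gf rank_triple_def)
  have C: "Abs_fps (\<lambda>i. Poly_Mapping.lookup (fps_nth (laurent_gf crank_count oo fps_X ^ 3) i) m) =
      Abs_fps (crank_count m) oo fps_X ^ 3"
    by (rule fps_ext)
       (simp add: fps_nth_compose_X_power lookup_laurent_gf finite_crank_count_support)
  show "Poly_Mapping.lookup (fps_nth ((mset_gf positive_msets oo fps_X ^ 3) * laurent_gf rank_triple) n) m =
      Poly_Mapping.lookup (fps_nth (mset_gf positive_msets * (laurent_gf crank_count oo fps_X ^ 3)) n) m"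
    unfolding P3 unfolding P lookup_fps_mult_of_nat R C
    using rank_triple_crank_count[of m] unfolding P3 unfolding P by simp
qed

theorem theorem4p1:
  shows "laurent_gf (\<lambda>m n. int (rank_count (3 * m) n + rank_count (3 * m + 1) n
                                + rank_count (3 * m - 1) n)) =
           qpoch_inf (fps_X ^ 3) (fps_X ^ 3) * fps_right_inverse (qpoch_inf fps_X fps_X) 1
             * (laurent_gf crank_count oo fps_X ^ 3)"
proof -
  let ?E = "\<lambda>k. qpoch_inf (fps_X ^ k) (fps_X ^ k) :: (int \<Rightarrow>\<^sub>0 int) fps"
  let ?P = "mset_gf positive_msets :: (int \<Rightarrow>\<^sub>0 int) fps"
  let ?I = "fps_right_inverse (qpoch_inf fps_X fps_X) 1 :: (int \<Rightarrow>\<^sub>0 int) fps"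
  let ?C = "laurent_gf crank_count oo fps_X ^ 3"
  have P: "qpoch_inf fps_X fps_X * ?P = 1"
    using qpoch_inf_mult_mset_gf[of 1, where ?'a = "int \<Rightarrow>\<^sub>0 int"] by simp
  \<comment> \<open>Both \<open>?P\<close> and \<open>?I\<close> invert the same series, hence
    agree.\<close>
  have "?I = (qpoch_inf fps_X fps_X * ?P) * ?I" by (simp only: P mult_1_left)
  also have "\<dots> = ?P * (qpoch_inf fps_X fps_X * ?I)" by (simp only: mult_ac)
  also have "\<dots> = ?P" by (simp only: qpoch_inf_right_inverse mult_1_right)
  finally have I: "?I = ?P" .
  have "?E 3 * ?I * ?C = ?E 3 * (?P * ?C)" by (simp only: I mult.assoc)
  also have "\<dots> = ?E 3 * (?P oo fps_X ^ 3) * laurent_gf rank_triple"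
    by (simp only: laurent_gf_rank_crank[symmetric] mult.assoc)
  \<comment> \<open>Euler's product at \<open>q^3\<close> cancels the prefactor.\<close>
  also have "\<dots> = laurent_gf rank_triple"
    by (simp only: qpoch_inf_mult_mset_gf[OF zero_less_numeral] mult_1_left)
  finally show ?thesis by (simp only: rank_triple_def[abs_def])
qed

end
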